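(* There exists a constant $C_n>0$ depending only on $n$ such that for every convex body $K\subset\mathbb R^n$, $$\big|\#(K\cap\mathbb Z^n)-\mathrm{vol}_n(K)\big|\le C_n\sum_{j=0}^{n-1}V_j(K).$$ Moreover, if $K$ ranges in a one-parameter homothetic family $\{K_t=tK_0\}_{t>0}$ with a fixed convex body $K_0\subset\mathbb R^n$, then there exists a constant $C_{K_0}>0$ such that for all $t>0$, $$\big|\#(K_t\cap\mathbb Z^n)-\mathrm{vol}_n(K_t)\big|\le C_nC_{K_0}\big(1+V_{n-1}(K_t)\big).$$
   Context: $n\ge2$ is a fixed natural number. A convex body is a compact convex set with nonempty interior. The intrinsic volumes $V_j(K)$, $0\le j\le n$, are defined by the Steiner formula $\mathrm{vol}_n(K+\varepsilon B^n)=\sum_{j=0}^n\kappa_{n-j}V_j(K)\varepsilon^{n-j}$, $\varepsilon\ge0$, where $B^n$ is the Euclidean unit ball and $\kappa_m$ is the volume of the unit ball of $\mathbb R^m$. *)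

theory Defs
  imports "HOL-Analysis.Analysis" "HOL-Library.Set_Algebras"
begin

definition convex_body :: "'a::euclidean_space set \<Rightarrow> bool" where
  "convex_body K \<longleftrightarrow> compact K \<and> convex K \<and> interior K \<noteq> {}"

definition integer_lattice :: "(real ^ 'n) set" where
  "integer_lattice = {x. \<forall>i. x $ i \<in> \<int>}"

abbreviation vol :: "'a::euclidean_space set \<Rightarrow> real" where
  "vol \<equiv> measure lebesgue"

(* The sum of sets is the Minkowski sum. The Steiner formula determines V only on {0..n};
   the condition V j = 0 for j > n makes V unique as a function on all of nat. *)
definition steiner_formula :: "'a::euclidean_space set \<Rightarrow> (nat \<Rightarrow> real) \<Rightarrow> bool" where
  "steiner_formula K V \<longleftrightarrow>
     (\<forall>j>DIM('a). V j = 0) \<and>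
     (\<forall>\<epsilon>\<ge>0. vol (K + (*\<^sub>R) \<epsilon> ` cball 0 1) =
        (\<Sum>j=0..DIM('a). unit_ball_vol (real (DIM('a) - j)) * V j * \<epsilon> ^ (DIM('a) - j)))"

definition intrinsic_volume :: "nat \<Rightarrow> 'a::euclidean_space set \<Rightarrow> real" where
  "intrinsic_volume j K = (THE V. steiner_formula K V) j"

end

theory Submission
  imports Defs
begin

text \<open>
  Adding a segment \<open>[-v, v]\<close> to a convex body changes the volume affinely in the length of the
  segment, with a slope that is again nonnegative, monotone and affine along segments. Hence the volume
  of \<open>K + t Z\<close>, for a finite sum of segments \<open>Z\<close>, is a polynomial in \<open>t\<close> with nonnegative coefficients, of
  degree at most \<open>n\<close> by growth. The ball is a limit of such sums, because the mean of \<open>|u \<bullet> v|\<close> over the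
  ball is proportional to \<open>|u|\<close>. In the limit one gets the Steiner formula with nonnegative
  intrinsic volumes.

  The unit cubes at the lattice points of \<open>K\<close> lie in \<open>K + r B\<close>, and they cover \<open>K\<close> up to an inner shell
  whose volume is bounded by a multiple of that of \<open>K + r B\<close> outside \<open>K\<close>. So the discrepancy is bounded by
  the outer shell, which the Steiner formula expresses by \<open>V_0, \<dots>, V_{n-1}\<close>. For a homothetic
  family, \<open>V_j (t K) = t^j V_j (K)\<close>, and \<open>V_{n-1} (K) > 0\<close> allows to absorb the lower terms.
\<close>

section \<open>Volume and Minkowski sums with segments\<close>

text \<open>Cauchy's functional equation for monotone functions. Squeezing \<open>n * t\<close>
  between consecutive integers bounds \<open>n\<close> times the deviation from linearity by
  \<open>g 1\<close>, for every \<open>n\<close>, so the deviation is 0.\<close>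

lemma additive_mono_imp_linear:
  fixes g :: "real \<Rightarrow> real"
  assumes add: "\<And>s t. s \<ge> 0 \<Longrightarrow> t \<ge> 0 \<Longrightarrow> g (s + t) = g s + g t"
    and mono: "\<And>s t. 0 \<le> s \<Longrightarrow> s \<le> t \<Longrightarrow> g s \<le> g t"
    and "t \<ge> 0"
  shows "g t = t * g 1"
proof -
  have g0: "g 0 = 0"
    using add[of 0 0] by simp
  have mult: "g (real n * s) = real n * g s" if "s \<ge> 0" for n s
    by (induction n) (use that g0 add in \<open>auto simp: distrib_right\<close>)
  have g1: "g 1 \<ge> 0"
    using mono[of 0 1] g0 by simp
  have bound: "real n * \<bar>g t - t * g 1\<bar> \<le> g 1" for n
  proof -
    define m where "m = nat \<lfloor>real n * t\<rfloor>"
    have m: "real m \<le> real n * t" "real n * t \<le> real (Suc m)"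
      using \<open>t \<ge> 0\<close> unfolding m_def
      by (simp_all add: of_nat_nat) linarith+
    have "real m * g 1 \<le> real n * g t"
      using mono[OF _ m(1)] mult[of 1 m] mult[OF \<open>t \<ge> 0\<close>, of n] by simp
    moreover have "real n * g t \<le> real (Suc m) * g 1"
      using mono[OF _ m(2)] mult[of 1 "Suc m"] mult[OF \<open>t \<ge> 0\<close>, of n] \<open>t \<ge> 0\<close> by simp
    moreover have "real m * g 1 \<le> real n * t * g 1" "real n * t * g 1 \<le> real (Suc m) * g 1"
      using m g1 by (intro mult_right_mono; simp)+
    ultimately have "\<bar>real n * g t - real n * t * g 1\<bar> \<le> g 1"
      by (simp add: algebra_simps abs_le_iff)
    then show ?thesis
      by (metis abs_mult abs_of_nat mult.assoc right_diff_distrib)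
  qed
  have "\<bar>g t - t * g 1\<bar> = 0"
  proof (rule ccontr)
    assume "\<bar>g t - t * g 1\<bar> \<noteq> 0"
    then have "\<bar>g t - t * g 1\<bar> > 0" by simp
    then obtain n where "real n * \<bar>g t - t * g 1\<bar> > g 1"
      using reals_Archimedean3 by blast
    with bound[of n] show False by simp
  qed
  then show ?thesis by simp
qed

lemma compact_set_plus:
  fixes K L :: "'a::euclidean_space set"
  assumes "compact K" "compact L"
  shows "compact (K + L)"
proof -
  have "K + L = (\<Union>x\<in>K. \<Union>y\<in>L. {x + y})"
    by (auto simp: set_plus_def)
  then show ?thesis
    using compact_sums'[OF assms] by simp
qed

lemma vol_mono:
  fixes K L :: "'a::euclidean_space set"
  assumes "compact K" "compact L" "K \<subseteq> L"
  shows "vol K \<le> vol L"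
  using assms by (intro measure_mono_fmeasurable) (auto intro: lmeasurable_compact fmeasurableD)

lemma vol_diff:
  fixes K L :: "'a::euclidean_space set"
  assumes "compact K" "compact L" "K \<subseteq> L"
  shows "vol (L - K) = vol L - vol K"
proof -
  have "K \<in> lmeasurable" "L \<in> lmeasurable"
    using assms by (auto intro: lmeasurable_compact)
  then show ?thesis
    using \<open>K \<subseteq> L\<close> by (intro measure_Diff) (auto simp: fmeasurable_def)
qed

lemma closed_segment_scaleR:
  assumes "t \<ge> 0"
  shows "closed_segment 0 (t *\<^sub>R v) = (\<lambda>a. a *\<^sub>R v) ` {0..t}"
proof -
  have "closed_segment 0 (t *\<^sub>R v) = (\<lambda>a. a *\<^sub>R v) ` closed_segment 0 t"
    using closed_segment_linear_image[of "\<lambda>a. a *\<^sub>R v" 0 t]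
    by (simp add: linear_scaleR_left)
  also have "closed_segment 0 t = {0..t}"
    using assms by (simp add: closed_segment_eq_real_ivl)
  finally show ?thesis .
qed

text \<open>Translating the shell by \<open>-t v\<close> identifies it with the shell at parameter 0;
  convexity is what keeps the translated points outside \<open>K\<close>.\<close>

lemma convex_add_segment_shell:
  fixes K :: "'a::real_vector set"
  assumes "convex K" "s \<ge> 0" "t \<ge> 0"
  shows "(K + closed_segment 0 ((t + s) *\<^sub>R v)) - (K + closed_segment 0 (t *\<^sub>R v)) =
    (+) (t *\<^sub>R v) ` ((K + closed_segment 0 (s *\<^sub>R v)) - K)"
proof -
  have E: "K + closed_segment 0 (r *\<^sub>R v) = {k + a *\<^sub>R v |k a. k \<in> K \<and> 0 \<le> a \<and> a \<le> r}" if "r \<ge> 0" for r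
    using that by (fastforce simp: closed_segment_scaleR set_plus_def)
  have 1: "y \<in> (+) (t *\<^sub>R v) ` ((K + closed_segment 0 (s *\<^sub>R v)) - K)"
    if y: "y \<in> K + closed_segment 0 ((t + s) *\<^sub>R v)" "y \<notin> K + closed_segment 0 (t *\<^sub>R v)" for y
  proof -
    obtain k a where ka: "y = k + a *\<^sub>R v" "k \<in> K" "0 \<le> a" "a \<le> t + s"
      using y(1) assms by (auto simp: E)
    have "\<not> a \<le> t"
    proof
      assume "a \<le> t"
      then have "y \<in> K + closed_segment 0 (t *\<^sub>R v)"
        using ka assms by (auto simp: E)
      with y(2) show False ..
    qed
    then have "a > t" by simp
    have "y = t *\<^sub>R v + (k + (a - t) *\<^sub>R v)"
      using ka by (simp add: algebra_simps)
    moreover have "k + (a - t) *\<^sub>R v \<in> K + closed_segment 0 (s *\<^sub>R v)"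
      using ka \<open>a > t\<close> assms by (auto simp: E intro!: exI[of _ k] exI[of _ "a - t"])
    moreover have "k + (a - t) *\<^sub>R v \<notin> K"
    proof
      assume "k + (a - t) *\<^sub>R v \<in> K"
      moreover have "y = (k + (a - t) *\<^sub>R v) + t *\<^sub>R v"
        using ka by (simp add: algebra_simps)
      ultimately show False
        using y(2) assms by (auto simp: E)
    qed
    ultimately show ?thesis by blast
  qed
  have 2: "t *\<^sub>R v + x \<in> K + closed_segment 0 ((t + s) *\<^sub>R v)" and
    3: "t *\<^sub>R v + x \<notin> K + closed_segment 0 (t *\<^sub>R v)"
    if x: "x \<in> K + closed_segment 0 (s *\<^sub>R v)" "x \<notin> K" for x
  proof -
    obtain k a where ka: "x = k + a *\<^sub>R v" "k \<in> K" "0 \<le> a" "a \<le> s"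
      using x(1) assms by (auto simp: E)
    have "t *\<^sub>R v + x = k + (a + t) *\<^sub>R v"
      using ka by (simp add: algebra_simps)
    then show "t *\<^sub>R v + x \<in> K + closed_segment 0 ((t + s) *\<^sub>R v)"
      using ka assms by (auto simp: E intro!: exI[of _ k] exI[of _ "a + t"])
    show "t *\<^sub>R v + x \<notin> K + closed_segment 0 (t *\<^sub>R v)"
    proof
      assume "t *\<^sub>R v + x \<in> K + closed_segment 0 (t *\<^sub>R v)"
      then obtain l b where lb: "t *\<^sub>R v + x = l + b *\<^sub>R v" "l \<in> K" "0 \<le> b" "b \<le> t"
        using assms by (auto simp: E)
      define c where "c = t - b"
      have l: "l = x + c *\<^sub>R v" and "c \<ge> 0"
        using lb by (auto simp: algebra_simps c_def)
      have "a > 0"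
        using ka x(2) by (cases "a = 0") auto
      \<comment> \<open>Here \<open>k = x - a v\<close> and \<open>l = x + c v\<close> lie on
        opposite sides of \<open>x\<close> on a line in direction \<open>v\<close>. These weights
        recover \<open>x\<close>, so convexity would put it into \<open>K\<close>.\<close>
      have "(c / (a + c)) *\<^sub>R k + (a / (a + c)) *\<^sub>R l \<in> K"
        using \<open>a > 0\<close> \<open>c \<ge> 0\<close> ka lb assms
        by (intro convexD) (auto simp: add_divide_distrib[symmetric])
      moreover have "(c / (a + c)) *\<^sub>R k + (a / (a + c)) *\<^sub>R l = x"
      proof -
        have k: "k = x - a *\<^sub>R v"
          using ka by simp
        have "(c / (a + c)) *\<^sub>R k + (a / (a + c)) *\<^sub>R l =
          (c / (a + c) + a / (a + c)) *\<^sub>R x + (a / (a + c) * c - c / (a + c) * a) *\<^sub>R v"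
          unfolding k l by (simp add: algebra_simps)
        also have "c / (a + c) + a / (a + c) = 1"
          using \<open>a > 0\<close> \<open>c \<ge> 0\<close> by (simp add: add_divide_distrib[symmetric])
        finally show ?thesis by simp
      qed
      ultimately show False using x by simp
    qed
  qed
  from 1 2 3 show ?thesis by blast
qed

text \<open>The volume gained by adding a segment is additive in its length, since the shell between
  lengths \<open>t\<close> and \<open>t + s\<close> is a translate of the first shell of length
  \<open>s\<close>. It is also monotone, hence linear.\<close>

lemma vol_add_segment_0:
  fixes K :: "'a::euclidean_space set"
  assumes K: "compact K" "convex K" and "t \<ge> 0"
  shows "vol (K + closed_segment 0 (t *\<^sub>R v)) = vol K + t * (vol (K + closed_segment 0 v) - vol K)"
proof -
  define g where "g t = vol (K + closed_segment 0 (t *\<^sub>R v)) - vol K" for t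
  have c: "compact (K + closed_segment 0 (t *\<^sub>R v))" for t
    by (intro compact_set_plus K compact_segment)
  have sub: "K + closed_segment 0 (s *\<^sub>R v) \<subseteq> K + closed_segment 0 (t *\<^sub>R v)" if "0 \<le> s" "s \<le> t" for s t
    using that by (intro set_plus_mono2) (auto simp: closed_segment_scaleR)
  have sub0: "K \<subseteq> K + closed_segment 0 (t *\<^sub>R v)" for t
    using set_zero_plus2[of "closed_segment 0 (t *\<^sub>R v)" K] by (simp add: add.commute)
  have "g t = t * g 1"
  proof (rule additive_mono_imp_linear)
    show "g s \<le> g t" if "0 \<le> s" "s \<le> t" for s t
      unfolding g_def using vol_mono[OF c c sub[OF that]] by simp
    show "g (s + t) = g s + g t" if "s \<ge> 0" "t \<ge> 0" for s t
    proof -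
      have "vol (K + closed_segment 0 ((t + s) *\<^sub>R v)) - vol (K + closed_segment 0 (t *\<^sub>R v)) =
        vol (K + closed_segment 0 (s *\<^sub>R v)) - vol K"
        using convex_add_segment_shell[OF K(2) that, of v] sub[of t "t + s"] that
        by (simp add: measure_translation vol_diff[symmetric] c sub0 K)
      then show ?thesis
        by (simp add: g_def add.commute)
    qed
  qed fact
  then show ?thesis
    by (simp add: g_def)
qed

text \<open>The segment from \<open>- w\<close> to \<open>w\<close> is a translate of the one from 0
  to \<open>2 w\<close>, and translations preserve volume.\<close>

lemma vol_add_segment:
  fixes K :: "'a::euclidean_space set"
  assumes K: "compact K" "convex K" and "t \<ge> 0"
  shows "vol (K + closed_segment (- (t *\<^sub>R v)) (t *\<^sub>R v)) =
    vol K + t * (vol (K + closed_segment (- v) v) - vol K)"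
proof -
  have "vol (K + closed_segment (- w) w) = vol (K + closed_segment 0 (2 *\<^sub>R w))" for w
  proof -
    have "closed_segment (- w) w = (+) (- w) ` closed_segment 0 (2 *\<^sub>R w)"
      using closed_segment_translation[of "- w" 0 "2 *\<^sub>R w"] by (simp add: scaleR_2)
    then have "K + closed_segment (- w) w = (+) (- w) ` (K + closed_segment 0 (2 *\<^sub>R w))"
      by (simp add: set_plus_image image_image split_beta image_paired_Times flip: image_UN)
        (auto simp: image_iff algebra_simps; force)
    then show ?thesis
      by (simp add: measure_translation_subtract)
  qed
  then show ?thesis
    using vol_add_segment_0[OF assms, of "2 *\<^sub>R v"] by (simp add: mult.commute)
qed

text \<open>These properties of the volume are chosen so that they pass from \<open>F\<close> to its
  slope along any segment. This closure is what allows an induction on the number of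
  segments.\<close>

definition segment_affine :: "('a::euclidean_space set \<Rightarrow> real) \<Rightarrow> bool" where
  "segment_affine F \<longleftrightarrow>
     (\<forall>K. compact K \<longrightarrow> convex K \<longrightarrow> F K \<ge> 0) \<and>
     (\<forall>K L. compact K \<longrightarrow> convex K \<longrightarrow> compact L \<longrightarrow> convex L \<longrightarrow> K \<subseteq> L \<longrightarrow> F K \<le> F L) \<and>
     (\<forall>K v t. compact K \<longrightarrow> convex K \<longrightarrow> t \<ge> 0 \<longrightarrow>
        F (K + closed_segment (- (t *\<^sub>R v)) (t *\<^sub>R v)) =
          F K + t * (F (K + closed_segment (- v) v) - F K))"

lemma segment_affine_vol: "segment_affine vol"
  unfolding segment_affine_def by (auto intro: vol_mono vol_add_segment)

lemma subset_add_segment: "K \<subseteq> K + closed_segment (- v) (v :: 'a::real_vector)"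
proof -
  have "0 = (1 - 1 / 2) *\<^sub>R (- v) + (1 / 2) *\<^sub>R v"
    by (simp add: scaleR_diff_left)
  then have "0 \<in> closed_segment (- v) v"
    unfolding in_segment by (intro exI[of _ "1 / 2"]) simp
  then show ?thesis
    by (metis add.commute set_zero_plus2)
qed

text \<open>Monotonicity of the slope comes from letting \<open>t\<close> tend to infinity in
  \<open>F (K + t S) \<le> F (L + t S)\<close>, both sides being affine in \<open>t\<close>.\<close>

lemma segment_affine_slope:
  assumes F: "segment_affine F"
  shows "segment_affine (\<lambda>K. F (K + closed_segment (- v) v) - F K)"
proof -
  define S where "S t = closed_segment (- (t *\<^sub>R v)) (t *\<^sub>R v)" for t
  have pos: "F K \<ge> 0" if "compact K" "convex K" for K
    using F that unfolding segment_affine_def by blast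
  have mono: "F K \<le> F L" if "compact K" "convex K" "compact L" "convex L" "K \<subseteq> L" for K L
    using F that unfolding segment_affine_def by blast
  have aff: "F (K + closed_segment (- (t *\<^sub>R w)) (t *\<^sub>R w)) =
      F K + t * (F (K + closed_segment (- w) w) - F K)"
    if "compact K" "convex K" "t \<ge> 0" for K w t
    using F that unfolding segment_affine_def by blast
  have cs: "compact (K + closed_segment (- w) w)" "convex (K + closed_segment (- w) w)"
    if "compact K" "convex K" for K :: "'a set" and w
    using that by (simp_all add: compact_set_plus convex_set_plus)
  show ?thesis
    unfolding segment_affine_def
  proof (intro conjI allI impI)
    fix K :: "'a set" assume K: "compact K" "convex K"
    show "F (K + closed_segment (- v) v) - F K \<ge> 0"
      using mono[OF K cs[OF K] subset_add_segment] by simp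
  next
    fix K L :: "'a set"
    assume K: "compact K" "convex K" and L: "compact L" "convex L" and "K \<subseteq> L"
    define a where "a = F (K + closed_segment (- v) v) - F K"
    define b where "b = F (L + closed_segment (- v) v) - F L"
    have le: "F K + t * a \<le> F L + t * b" if "t \<ge> 0" for t
      unfolding a_def b_def
      using mono[OF cs[OF K] cs[OF L], of "t *\<^sub>R v" "t *\<^sub>R v"] \<open>K \<subseteq> L\<close>
      by (simp add: set_plus_mono2 aff K L that)
    have "a \<le> b"
    proof (rule ccontr)
      assume "\<not> a \<le> b"
      \<comment> \<open>Chosen so that the gain \<open>t * (a - b)\<close> exceeds the initial gap
        \<open>F L - F K\<close> by exactly 1.\<close>
      define t where "t = (F L - F K + 1) / (a - b)"
      have "t \<ge> 0"
        unfolding t_def using \<open>\<not> a \<le> b\<close> mono[OF K L \<open>K \<subseteq> L\<close>] by simp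
      moreover have "t * (a - b) = F L - F K + 1"
        unfolding t_def using \<open>\<not> a \<le> b\<close> by simp
      ultimately show False
        using le[of t] by (simp add: algebra_simps)
    qed
    then show "F (K + closed_segment (- v) v) - F K \<le> F (L + closed_segment (- v) v) - F L"
      by (simp add: a_def b_def)
  next
    fix K :: "'a set" and w :: 'a and t :: real
    assume K: "compact K" "convex K" and "t \<ge> 0"
    let ?S = "closed_segment (- v) v" and ?T = "closed_segment (- w) w"
      and ?tT = "closed_segment (- (t *\<^sub>R w)) (t *\<^sub>R w)"
    have "F (K + ?tT + ?S) = F (K + ?S + ?tT)" "F (K + ?S + ?T) = F (K + ?T + ?S)"
      by (simp_all add: ac_simps)
    then show "F (K + ?tT + ?S) - F (K + ?tT) =
        F (K + ?S) - F K + t * (F (K + ?T + ?S) - F (K + ?T) - (F (K + ?S) - F K))"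
      using aff[OF cs[OF K, of v] \<open>t \<ge> 0\<close>, of w] aff[OF K \<open>t \<ge> 0\<close>, of w]
      by (simp add: algebra_simps)
  qed
qed

section \<open>Zonotopes: polynomial growth of volume and comparison with balls\<close>

definition zonotope :: "'i set \<Rightarrow> ('i \<Rightarrow> 'a::euclidean_space) \<Rightarrow> 'a set" where
  "zonotope I v = (\<Sum>i\<in>I. closed_segment (- v i) (v i))"

lemma zonotope_insert:
  "finite I \<Longrightarrow> i \<notin> I \<Longrightarrow> zonotope (insert i I) v = closed_segment (- v i) (v i) + zonotope I v"
  by (simp add: zonotope_def)

lemma zonotope_empty [simp]: "zonotope {} v = 0"
  by (simp add: zonotope_def)

lemma
  fixes v :: "'i \<Rightarrow> 'a::euclidean_space"
  assumes "finite I"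
  shows compact_zonotope: "compact (zonotope I v)"
    and convex_zonotope: "convex (zonotope I v)"
  using assms
  by (induction I rule: finite_induct)
    (auto simp: zonotope_insert intro: compact_set_plus convex_set_plus)

text \<open>Induction on the segments with \<open>F\<close> left arbitrary: a new segment turns
  \<open>F\<close> into \<open>F + t * G\<close>, where the slope \<open>G\<close> is again covered
  by the hypothesis. The new polynomial \<open>p + t * q\<close> inherits nonnegative
  coefficients.\<close>

lemma segment_affine_zonotope_poly:
  fixes v :: "'i \<Rightarrow> 'a::euclidean_space"
  assumes "finite I" "segment_affine F" "compact K" "convex K"
  shows "\<exists>p. (\<forall>j. coeff p j \<ge> 0) \<and> (\<forall>t\<ge>0. F (K + zonotope I (\<lambda>i. t *\<^sub>R v i)) = poly p t)"
  using assms
proof (induction I arbitrary: F K rule: finite_induct)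
  case empty
  then have "F K \<ge> 0"
    by (simp add: segment_affine_def)
  then show ?case
    by (intro exI[of _ "[:F K:]"]) (auto simp: coeff_pCons split: nat.split)
next
  case (insert i I)
  define G where "G = (\<lambda>K. F (K + closed_segment (- v i) (v i)) - F K)"
  obtain p where p: "\<And>j. coeff p j \<ge> 0" "\<And>t. t \<ge> 0 \<Longrightarrow> F (K + zonotope I (\<lambda>i. t *\<^sub>R v i)) = poly p t"
    using insert by blast
  have "segment_affine G"
    unfolding G_def by (intro segment_affine_slope insert.prems)
  then obtain q where q: "\<And>j. coeff q j \<ge> 0" "\<And>t. t \<ge> 0 \<Longrightarrow> G (K + zonotope I (\<lambda>i. t *\<^sub>R v i)) = poly q t"
    using insert by blast
  have "F (K + zonotope (insert i I) (\<lambda>i. t *\<^sub>R v i)) = poly (p + pCons 0 q) t" if "t \<ge> 0" for t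
  proof -
    let ?L = "K + zonotope I (\<lambda>i. t *\<^sub>R v i)"
    have "compact ?L" "convex ?L"
      using insert by (auto intro: compact_set_plus convex_set_plus compact_zonotope convex_zonotope)
    then have "F (?L + closed_segment (- (t *\<^sub>R v i)) (t *\<^sub>R v i)) = F ?L + t * G ?L"
      using insert.prems that unfolding segment_affine_def G_def by blast
    also have "?L + closed_segment (- (t *\<^sub>R v i)) (t *\<^sub>R v i) = K + zonotope (insert i I) (\<lambda>i. t *\<^sub>R v i)"
      using insert by (simp add: zonotope_insert ac_simps)
    finally show ?thesis
      using that p q by simp
  qed
  moreover have "coeff (p + pCons 0 q) j \<ge> 0" for j
    using p q by (auto simp: coeff_pCons split: nat.split)
  ultimately show ?case by blast
qed

text \<open>The sum of the \<open>\<bar>u \<bullet> v i\<bar>\<close> is the support function of the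
  zonotope at \<open>u\<close>. Testing a point \<open>x\<close> of the zonotope against
  \<open>u = x\<close> bounds its norm.\<close>

lemma zonotope_subset_cball:
  fixes v :: "'i \<Rightarrow> 'a::euclidean_space"
  assumes "finite I" and le: "\<And>u. (\<Sum>i\<in>I. \<bar>u \<bullet> v i\<bar>) \<le> r * norm u"
  shows "zonotope I v \<subseteq> cball 0 r"
proof
  fix x assume "x \<in> zonotope I v"
  then obtain s where x: "x = sum s I" and s: "\<forall>i\<in>I. s i \<in> closed_segment (- v i) (v i)"
    using \<open>finite I\<close> by (auto simp: zonotope_def set_sum_alt)
  have "x \<bullet> x = (\<Sum>i\<in>I. x \<bullet> s i)"
    by (simp add: x inner_sum_right flip: inner_sum_left)
  also have "\<dots> \<le> (\<Sum>i\<in>I. \<bar>x \<bullet> v i\<bar>)"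
  proof (rule sum_mono)
    fix i assume "i \<in> I"
    with s obtain a where a: "0 \<le> a" "a \<le> 1" "s i = (1 - a) *\<^sub>R (- v i) + a *\<^sub>R v i"
      by (auto simp: in_segment)
    have "x \<bullet> s i = (2 * a - 1) * (x \<bullet> v i)"
      unfolding a(3) by (simp add: inner_simps algebra_simps)
    also have "\<dots> \<le> \<bar>2 * a - 1\<bar> * \<bar>x \<bullet> v i\<bar>"
      by (simp flip: abs_mult)
    also have "\<dots> \<le> 1 * \<bar>x \<bullet> v i\<bar>"
      using a by (intro mult_right_mono) auto
    finally show "x \<bullet> s i \<le> \<bar>x \<bullet> v i\<bar>" by simp
  qed
  also have "\<dots> \<le> r * norm x"
    by (rule le)
  finally have "norm x * norm x \<le> r * norm x"
    by (simp add: dot_square_norm power2_eq_square)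
  moreover have "r \<ge> 0"
  proof -
    obtain b :: 'a where "norm b = 1"
      using vector_choose_size[of 1] by auto
    moreover have "0 \<le> (\<Sum>i\<in>I. \<bar>b \<bullet> v i\<bar>)"
      by (intro sum_nonneg) auto
    ultimately show ?thesis
      using le[of b] by (smt (verit) mult_cancel_left1)
  qed
  ultimately show "x \<in> cball 0 r"
    by (cases "x = 0") auto
qed

text \<open>A point outside the zonotope is strictly separated from it by some \<open>u\<close>, but
  the support function in direction \<open>u\<close> is too large for a point of the ball to be cut
  off.\<close>

lemma cball_subset_zonotope:
  fixes v :: "'i \<Rightarrow> 'a::euclidean_space"
  assumes "finite I" and ge: "\<And>u. r * norm u \<le> (\<Sum>i\<in>I. \<bar>u \<bullet> v i\<bar>)"
  shows "cball 0 r \<subseteq> zonotope I v"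
proof
  fix x :: 'a assume x: "x \<in> cball 0 r"
  show "x \<in> zonotope I v"
  proof (rule ccontr)
    assume "x \<notin> zonotope I v"
    then obtain u b where u: "u \<bullet> x < b" "\<And>z. z \<in> zonotope I v \<Longrightarrow> u \<bullet> z > b"
      using separating_hyperplane_closed_point[of "zonotope I v" x]
        compact_zonotope[OF \<open>finite I\<close>] convex_zonotope[OF \<open>finite I\<close>] compact_imp_closed by metis
    \<comment> \<open>Choosing the right endpoint of each segment gives a point that minimizes the
      inner product with \<open>u\<close> over the zonotope.\<close>
    define z where "z = (\<Sum>i\<in>I. (if u \<bullet> v i \<ge> 0 then - v i else v i))"
    have "z \<in> zonotope I v"
      using \<open>finite I\<close> by (auto simp: z_def zonotope_def set_sum_alt)
    then have "b < u \<bullet> z"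
      by (rule u)
    also have "u \<bullet> z = - (\<Sum>i\<in>I. \<bar>u \<bullet> v i\<bar>)"
      unfolding z_def inner_sum_right sum_negf[symmetric] by (intro sum.cong) auto
    also have "\<dots> \<le> - (r * norm u)"
      using ge by simp
    finally have "r * norm u < - (u \<bullet> x)"
      using u(1) by simp
    also have "\<dots> \<le> norm u * norm x"
      using Cauchy_Schwarz_ineq2[of u x] by simp
    also have "\<dots> \<le> r * norm u"
      using x by (simp add: mult.commute[of r] mult_left_mono)
    finally show False by simp
  qed
qed

section \<open>Approximating the ball by zonotopes\<close>

text \<open>The library proves this only for index types of sort \<open>wellorder\<close>. Since orthogonal
  maps send balls to balls, Vitali's covering theorem gives it without determinants.\<close>

lemma lborel_distr_orthogonal:
  fixes f :: "'a::euclidean_space \<Rightarrow> 'a"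
  assumes f: "orthogonal_transformation f"
  shows "distr lborel borel f = lborel"
proof (rule lborel_eqI[symmetric])
  have lin: "linear f" and bij: "bij f"
    using f by (auto simp: orthogonal_transformation_linear orthogonal_transformation_bij)
  define g where "g = inv f"
  have g: "orthogonal_transformation g"
    unfolding g_def by (rule orthogonal_transformation_inv[OF f])
  have vimage: "f -` X = g ` X" for X
    unfolding g_def by (rule bij_vimage_eq_inv_image[OF bij])
  have f_meas: "f \<in> borel_measurable borel"
    using lin by (intro borel_measurable_continuous_onI linear_continuous_on)
      (simp add: linear_conv_bounded_linear)
  fix l u :: 'a
  assume le: "\<And>b. b \<in> Basis \<Longrightarrow> l \<bullet> b \<le> u \<bullet> b"
  \<comment> \<open>Pairs of centre and radius of the balls inside the box; around each point there
    are arbitrarily small ones, as a Vitali cover requires.\<close>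
  define K where "K = {(a, r). ball a r \<subseteq> box l u}"
  have "\<exists>i. i \<in> K \<and> x \<in> ball (fst i) (snd i) \<and> snd i < d" if "x \<in> box l u" "0 < d" for x d
  proof -
    obtain e where e: "e > 0" "ball x e \<subseteq> box l u"
      using open_box \<open>x \<in> box l u\<close> openE by blast
    have "ball x (min e (d / 2)) \<subseteq> box l u"
      using e by auto
    then show ?thesis
      using e \<open>0 < d\<close> by (intro exI[of _ "(x, min e (d / 2))"]) (auto simp: K_def)
  qed
  then obtain C where C: "countable C" "C \<subseteq> K"
    and disj: "pairwise (\<lambda>i j. disjnt (ball (fst i) (snd i)) (ball (fst j) (snd j))) C"
    and neg: "negligible (box l u - (\<Union>i\<in>C. ball (fst i) (snd i)))"
    by (rule Vitali_covering_theorem_balls[where K = K and S = "box l u" and a = fst and r = snd]) blast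
  define U where "U = (\<Union>i\<in>C. ball (fst i) (snd i))"
  have U: "U \<subseteq> box l u"
  proof
    fix x assume "x \<in> U"
    then obtain i where "i \<in> C" "x \<in> ball (fst i) (snd i)"
      by (auto simp: U_def)
    moreover from \<open>i \<in> C\<close> have "i \<in> K"
      using C(2) by blast
    then have "ball (fst i) (snd i) \<subseteq> box l u"
      by (simp add: K_def split_beta)
    ultimately show "x \<in> box l u" by blast
  qed
  have oU: "open U"
    unfolding U_def by auto
  have df: "disjoint_family_on (\<lambda>i. ball (fst i) (snd i)) C"
    using disj by (auto simp: disjoint_family_on_def pairwise_def disjnt_def)
  have eU: "emeasure lborel X = emeasure lborel Y" 
    if "Y \<subseteq> X" "X \<in> sets borel" "Y \<in> sets borel" "negligible (X - Y)" for X Y :: "'a set"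
  proof -
    have "X - Y \<in> null_sets lborel"
      using that by (simp add: negligible_iff_null_sets null_sets_completion_iff)
    then have "emeasure lborel (Y \<union> (X - Y)) = emeasure lborel Y"
      using that by (intro emeasure_Un_null_set) auto
    then show ?thesis
      using that by (simp add: Un_absorb1)
  qed
  have ball: "f -` ball a r = ball (g a) r" for a r
    unfolding vimage by (rule image_orthogonal_transformation_ball[OF g])
  have meas_vimage: "f -` X \<in> sets borel" if "X \<in> sets borel" for X
    using measurable_sets[OF f_meas that] by simp
  have "emeasure (distr lborel borel f) (box l u) = emeasure lborel (f -` box l u)"
    using f_meas by (subst emeasure_distr) auto
  also have "\<dots> = emeasure lborel (f -` U)"
  proof (rule eU)
    have "f -` box l u - f -` U = g ` (box l u - U)"
      by (metis vimage vimage_Diff)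
    then show "negligible (f -` box l u - f -` U)"
      using neg orthogonal_transformation_linear[OF g]
      by (auto simp: U_def intro!: negligible_differentiable_image_negligible linear_imp_differentiable_on)
  qed (use U oU in \<open>auto intro: meas_vimage\<close>)
  also have "f -` U = (\<Union>i\<in>C. f -` ball (fst i) (snd i))"
    by (auto simp: U_def)
  also have "emeasure lborel \<dots> = (\<integral>\<^sup>+i. emeasure lborel (f -` ball (fst i) (snd i)) \<partial>count_space C)"
  proof (rule emeasure_UN_countable)
    show "disjoint_family_on (\<lambda>i. f -` ball (fst i) (snd i)) C"
      using df unfolding disjoint_family_on_def by (metis vimage_Int vimage_empty)
  qed (use \<open>countable C\<close> in \<open>auto intro: meas_vimage\<close>)
  \<comment> \<open>The preimage of a ball is a ball of the same radius, so every term keeps its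
    measure. Negative radii give empty balls.\<close>
  also have "\<dots> = (\<integral>\<^sup>+i. emeasure lborel (ball (fst i) (snd i)) \<partial>count_space C)"
  proof -
    have "emeasure lborel (ball (g a) r) = emeasure lborel (ball a r)" for a r
      by (cases "r \<ge> 0") (simp_all add: emeasure_ball ball_empty)
    then show ?thesis
      by (simp add: ball)
  qed
  also have "\<dots> = emeasure lborel U"
    unfolding U_def using df \<open>countable C\<close> by (intro emeasure_UN_countable[symmetric]) auto
  also have "\<dots> = emeasure lborel (box l u)"
    using U oU neg by (intro eU[symmetric]) (auto simp: U_def)
  also have "\<dots> = (\<Prod>b\<in>Basis. (u - l) \<bullet> b)"
    using le by (simp add: emeasure_lborel_box)
  finally show "emeasure (distr lborel borel f) (box l u) = ennreal (\<Prod>b\<in>Basis. (u - l) \<bullet> b)" .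
qed simp

text \<open>The continuous analogue of the sum of the \<open>\<bar>u \<bullet> v i\<bar>\<close>:
  the support function of the zonoid generated by the segments from \<open>- v\<close> to
  \<open>v\<close>, with \<open>v\<close> spread uniformly over the unit ball.\<close>

definition ball_width :: "'a::euclidean_space \<Rightarrow> real" where
  "ball_width u = (LINT v:cball 0 1|lborel. \<bar>u \<bullet> v\<bar>)"

lemma set_integrable_abs_inner:
  assumes "A \<in> sets borel" "A \<subseteq> cball 0 r"
  shows "set_integrable lborel A (\<lambda>v. \<bar>u \<bullet> v\<bar>)"
proof (rule set_integrable_subset)
  show "set_integrable lborel (cball 0 r) (\<lambda>v. \<bar>u \<bullet> v\<bar>)"
    unfolding set_integrable_def
    by (rule borel_integrable_compact) (auto intro!: continuous_intros)
qed (use assms in auto)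

lemma ball_width_scaleR: "ball_width (a *\<^sub>R u) = \<bar>a\<bar> * ball_width u"
  unfolding ball_width_def set_lebesgue_integral_def
  by (simp add: abs_mult mult.left_commute flip: integral_mult_right_zero)

text \<open>Substituting \<open>f v\<close> for \<open>v\<close> preserves Lebesgue measure, the
  unit ball and the inner product.\<close>

lemma ball_width_orthogonal:
  fixes f :: "'a::euclidean_space \<Rightarrow> 'a"
  assumes f: "orthogonal_transformation f"
  shows "ball_width (f u) = ball_width u"
proof -
  have lin: "linear f"
    using f by (simp add: orthogonal_transformation_linear)
  have f_meas: "f \<in> borel_measurable borel"
    using lin by (intro borel_measurable_continuous_onI linear_continuous_on)
      (simp add: linear_conv_bounded_linear)
  have "ball_width (f u) =
    (LINT v|distr lborel borel f. indicator (cball 0 1) v *\<^sub>R \<bar>f u \<bullet> v\<bar>)"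
    by (simp add: ball_width_def set_lebesgue_integral_def lborel_distr_orthogonal[OF f])
  also have "\<dots> = (LINT v|lborel. indicator (cball 0 1) (f v) *\<^sub>R \<bar>f u \<bullet> f v\<bar>)"
  proof (rule integral_distr)
    show "(\<lambda>v. indicat_real (cball 0 1) v *\<^sub>R \<bar>f u \<bullet> v\<bar>) \<in> borel_measurable borel"
      by (intro borel_measurable_scaleR borel_measurable_indicator borel_measurable_continuous_onI
          continuous_intros) simp
  qed (use f_meas in simp)
  also have "\<dots> = (LINT v|lborel. indicator (cball 0 1) v *\<^sub>R \<bar>u \<bullet> v\<bar>)"
  proof -
    have "f u \<bullet> f v = u \<bullet> v" "norm (f v) = norm v" for v
      using f by (auto simp: orthogonal_transformation_def orthogonal_transformation_norm)
    then show ?thesis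
      by (simp add: indicator_def)
  qed
  finally show ?thesis
    by (simp add: ball_width_def set_lebesgue_integral_def)
qed

text \<open>A nonnegative integrand with integral 0 vanishes almost everywhere, but this one
  vanishes in the ball only on a hyperplane, which is a null set.\<close>

lemma ball_width_pos:
  fixes u :: "'a::euclidean_space"
  assumes "u \<noteq> 0"
  shows "ball_width u > 0"
proof -
  let ?f = "\<lambda>v. indicator (cball 0 1) v *\<^sub>R \<bar>u \<bullet> v\<bar>"
  have int: "integrable lborel ?f"
    using set_integrable_abs_inner[of "cball 0 1" 1 u] by (simp add: set_integrable_def)
  have "ball_width u \<noteq> 0"
  proof
    assume "ball_width u = 0"
    then have "AE v in lborel. ?f v = 0"
      using int unfolding ball_width_def set_lebesgue_integral_def
      by (subst (asm) integral_nonneg_eq_0_iff_AE) auto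
    moreover have "AE v in lborel. u \<bullet> v \<noteq> 0"
    proof -
      have "negligible {v. u \<bullet> v = 0}"
        using assms by (intro negligible_hyperplane) auto
      moreover have "{v. u \<bullet> v = 0} \<in> sets borel"
        by (intro borel_closed closed_hyperplane)
      ultimately have "{v. u \<bullet> v = 0} \<in> null_sets lborel"
        by (simp add: negligible_iff_null_sets null_sets_completion_iff)
      then show ?thesis
        by (rule AE_I') auto
    qed
    ultimately have "AE v in lborel. v \<notin> cball (0::'a) 1"
      by eventually_elim (auto simp: indicator_def)
    moreover have "{x. norm x \<le> 1} = cball (0::'a) 1"
      by auto
    ultimately have "emeasure lborel (cball (0::'a) 1) = 0"
      using AE_iff_measurable[of "cball (0::'a) 1" lborel "\<lambda>v. v \<notin> cball 0 1"] by simp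
    then show False
      using unit_ball_vol_pos[of "real DIM('a)"] by (simp add: emeasure_cball)
  qed
  moreover have "ball_width u \<ge> 0"
    unfolding ball_width_def set_lebesgue_integral_def by (intro integral_nonneg_AE) auto
  ultimately show ?thesis by simp
qed

text \<open>Orthogonal maps act transitively on each sphere, so the invariant function
  \<open>ball_width\<close> depends on the norm alone; homogeneity then makes it proportional to the
  norm.\<close>

lemma ball_width_eq_norm:
  obtains c where "c > 0" "\<And>u :: real ^ 'n. ball_width u = c * norm u"
proof -
  obtain e :: "real ^ 'n" where e: "norm e = 1"
    using vector_choose_size[of 1] by auto
  have "ball_width u = ball_width e * norm u" for u :: "real ^ 'n"
  proof -
    obtain f where f: "orthogonal_transformation f" "f (norm u *\<^sub>R e) = u"
      using orthogonal_transformation_exists[of "norm u *\<^sub>R e" u] e by auto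
    have "ball_width u = ball_width (norm u *\<^sub>R e)"
      using ball_width_orthogonal[OF f(1), of "norm u *\<^sub>R e"] f by simp
    then show ?thesis
      by (simp add: ball_width_scaleR mult.commute)
  qed
  moreover have "ball_width e > 0"
    using e by (intro ball_width_pos) auto
  ultimately show thesis using that by blast
qed

text \<open>A Riemann sum over a fine partition of the ball. By Cauchy-Schwarz the error is
  proportional to \<open>norm u\<close>, so one choice of weights and points serves all
  directions.\<close>

lemma ball_width_Riemann_sum:
  fixes \<delta> :: real
  assumes "\<delta> > 0"
  obtains n :: nat and w :: "nat \<Rightarrow> real" and p :: "nat \<Rightarrow> 'a::euclidean_space"
  where "\<And>i. w i \<ge> 0"
    "\<And>u. \<bar>ball_width u - (\<Sum>i<n. w i * \<bar>u \<bullet> p i\<bar>)\<bar> \<le> \<delta> * norm u * measure lborel (cball (0::'a) 1)"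
proof -
  obtain k where k: "finite k" "cball (0::'a) 1 \<subseteq> (\<Union>x\<in>k. ball x \<delta>)"
    using compact_cball[of "0::'a" 1] assms unfolding compact_eq_totally_bounded by blast
  obtain p and n :: nat where p: "k = p ` {..<n}"
    using \<open>finite k\<close> by (metis finite_imp_nat_seg_image_inj_on lessThan_def)
  \<comment> \<open>Making the finite cover disjoint gives a partition of the unit ball whose piece
    \<open>A i\<close> stays within distance \<open>\<delta>\<close> of \<open>p i\<close>.\<close>
  define A where "A i = cball (0::'a) 1 \<inter> disjointed (\<lambda>i. ball (p i) \<delta>) i" for i
  have A: "A i \<in> sets borel" "A i \<subseteq> cball 0 1" "A i \<subseteq> ball (p i) \<delta>" for i
    using disjointed_subset[of "\<lambda>i. ball (p i) \<delta>" i]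
    by (auto simp: A_def disjointed_def)
  have disj: "disjoint_family_on A {..<n}"
    using disjoint_family_disjointed[of "\<lambda>i. ball (p i) \<delta>"]
    by (fastforce simp: disjoint_family_on_def A_def)
  have un: "(\<Union>i<n. A i) = cball 0 1"
  proof -
    have "(\<Union>i<n. A i) = cball 0 1 \<inter> (\<Union>i<n. ball (p i) \<delta>)"
      using finite_UN_disjointed_eq[of "\<lambda>i. ball (p i) \<delta>" n]
      by (simp add: A_def atLeast0LessThan flip: Int_UN_distrib)
    also have "\<dots> = cball 0 1"
      using k by (auto simp: p)
    finally show ?thesis .
  qed
  have fin: "emeasure lborel (A i) < \<infinity>" for i
    using A by (intro order.strict_trans1[OF emeasure_mono emeasure_bounded_finite[of "cball 0 1"]]) auto
  define w where "w i = measure lborel (A i)" for i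
  have "\<bar>ball_width u - (\<Sum>i<n. w i * \<bar>u \<bullet> p i\<bar>)\<bar> \<le> \<delta> * norm u * measure lborel (cball (0::'a) 1)" for u
  proof -
    have int: "set_integrable lborel (A i) (\<lambda>v. \<bar>u \<bullet> v\<bar>)" for i
      using A by (intro set_integrable_abs_inner)
    have intc: "set_integrable lborel (A i) (\<lambda>v. c)" for i and c :: real
      using A fin unfolding set_integrable_def by simp
    have c: "(LINT v:A i|lborel. c) = w i * c" for i and c :: real
      using A fin unfolding set_lebesgue_integral_def w_def by simp
    have "ball_width u = (\<Sum>i<n. LINT v:A i|lborel. \<bar>u \<bullet> v\<bar>)"
      unfolding ball_width_def un[symmetric] using disj int A
      by (intro set_integral_finite_Union) auto
    then have "ball_width u - (\<Sum>i<n. w i * \<bar>u \<bullet> p i\<bar>) =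
      (\<Sum>i<n. LINT v:A i|lborel. \<bar>u \<bullet> v\<bar> - \<bar>u \<bullet> p i\<bar>)"
      using int intc by (simp add: set_integral_diff c sum_subtractf)
    also have "\<bar>\<dots>\<bar> \<le> (\<Sum>i<n. \<bar>LINT v:A i|lborel. \<bar>u \<bullet> v\<bar> - \<bar>u \<bullet> p i\<bar>\<bar>)"
      by (rule sum_abs)
    also have "\<dots> \<le> (\<Sum>i<n. w i * (\<delta> * norm u))"
    proof (rule sum_mono)
      fix i
      have dif: "\<bar>\<bar>u \<bullet> v\<bar> - \<bar>u \<bullet> p i\<bar>\<bar> \<le> \<delta> * norm u" if "v \<in> A i" for v
      proof -
        have "\<bar>\<bar>u \<bullet> v\<bar> - \<bar>u \<bullet> p i\<bar>\<bar> \<le> \<bar>u \<bullet> (v - p i)\<bar>"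
          by (simp add: inner_diff_right)
        also have "\<dots> \<le> norm u * norm (v - p i)"
          by (rule Cauchy_Schwarz_ineq2)
        also have "\<dots> \<le> norm u * \<delta>"
          using that A(3)[of i] by (intro mult_left_mono) (auto simp: dist_norm norm_minus_commute)
        finally show ?thesis by (simp add: mult.commute)
      qed
      have i: "set_integrable lborel (A i) (\<lambda>v. \<bar>u \<bullet> v\<bar> - \<bar>u \<bullet> p i\<bar>)"
        using int intc by (intro set_integral_diff)
      have "\<bar>LINT v:A i|lborel. \<bar>u \<bullet> v\<bar> - \<bar>u \<bullet> p i\<bar>\<bar> \<le> (LINT v:A i|lborel. \<bar>\<bar>u \<bullet> v\<bar> - \<bar>u \<bullet> p i\<bar>\<bar>)"
        using set_integral_norm_bound[OF i] by simp
      also have "\<dots> \<le> (LINT v:A i|lborel. \<delta> * norm u)"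
        using i intc dif by (intro set_integral_mono set_integrable_abs) auto
      finally show "\<bar>LINT v:A i|lborel. \<bar>u \<bullet> v\<bar> - \<bar>u \<bullet> p i\<bar>\<bar> \<le> w i * (\<delta> * norm u)"
        by (simp add: c mult_ac)
    qed
    also have "\<dots> = (\<Sum>i<n. w i) * (\<delta> * norm u)"
      by (simp add: sum_distrib_right)
    also have "(\<Sum>i<n. w i) = measure lborel (cball (0::'a) 1)"
      unfolding w_def un[symmetric] using A disj fin
      by (intro measure_finite_Union[symmetric]) (auto simp: less_top)
    finally show ?thesis
      by (simp add: mult_ac)
  qed
  then show thesis
    by (intro that[of w p n]) (auto simp: w_def)
qed

text \<open>Since the weights of the Riemann sum are nonnegative, they can be absorbed into the
  vectors, and division by \<open>c\<close> turns \<open>ball_width\<close> into the norm.\<close>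

lemma norm_approx_sum_abs_inner:
  assumes "\<eta> > 0"
  obtains n :: nat and v :: "nat \<Rightarrow> real ^ 'n"
  where "\<And>u. (1 - \<eta>) * norm u \<le> (\<Sum>i<n. \<bar>u \<bullet> v i\<bar>)" "\<And>u. (\<Sum>i<n. \<bar>u \<bullet> v i\<bar>) \<le> (1 + \<eta>) * norm u"
proof -
  obtain c where c: "c > 0" "\<And>u :: real ^ 'n. ball_width u = c * norm u"
    using ball_width_eq_norm by blast
  define \<kappa> where "\<kappa> = measure lborel (cball (0 :: real ^ 'n) 1)"
  have "\<kappa> > 0"
    by (simp add: \<kappa>_def)
  \<comment> \<open>This mesh size cancels the ball volume \<open>\<kappa>\<close> in the Riemann
    error and leaves a relative error \<open>\<eta>\<close>.\<close>
  then have "\<eta> * c / \<kappa> > 0"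
    using c assms by simp
  then obtain n w and p :: "nat \<Rightarrow> real ^ 'n" where w: "\<And>i. w i \<ge> 0"
    and b: "\<And>u. \<bar>ball_width u - (\<Sum>i<n. w i * \<bar>u \<bullet> p i\<bar>)\<bar> \<le> \<eta> * c / \<kappa> * norm u * \<kappa>"
    by (rule ball_width_Riemann_sum[where 'a = "real ^ 'n", folded \<kappa>_def]) (rule that)
  define v where "v i = (w i / c) *\<^sub>R p i" for i
  have "\<bar>norm u - (\<Sum>i<n. \<bar>u \<bullet> v i\<bar>)\<bar> \<le> \<eta> * norm u" for u
  proof -
    have "(\<Sum>i<n. w i * \<bar>u \<bullet> p i\<bar>) = c * (\<Sum>i<n. \<bar>u \<bullet> v i\<bar>)"
      using w c by (simp add: v_def sum_distrib_left abs_mult)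
    then have "\<bar>c * (norm u - (\<Sum>i<n. \<bar>u \<bullet> v i\<bar>))\<bar> \<le> c * (\<eta> * norm u)"
      using b[of u] c \<open>\<kappa> > 0\<close> by (simp add: field_simps)
    then show ?thesis
      using c by (simp add: abs_mult)
  qed
  then have "(1 - \<eta>) * norm u \<le> (\<Sum>i<n. \<bar>u \<bullet> v i\<bar>)" "(\<Sum>i<n. \<bar>u \<bullet> v i\<bar>) \<le> (1 + \<eta>) * norm u" for u
    unfolding abs_le_iff by (simp_all add: algebra_simps)
  then show thesis
    by (rule that)
qed

section \<open>The Steiner formula\<close>

lemma scaleR_cball_0_1:
  assumes "t \<ge> 0"
  shows "(*\<^sub>R) t ` cball (0::'a::euclidean_space) 1 = cball 0 t"
proof (cases "t = 0")
  case False
  have "x \<in> (*\<^sub>R) t ` cball 0 1" if "norm x \<le> t" for x :: 'a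
    using that False assms by (intro image_eqI[of _ _ "x /\<^sub>R t"]) (auto simp: field_simps)
  then show ?thesis
    using assms by (auto simp: mult_left_le)
qed (auto intro: image_eqI[of _ _ 0])

lemma vol_scaleR: "vol ((*\<^sub>R) t ` K) = \<bar>t\<bar> ^ DIM('a) * vol (K :: 'a::euclidean_space set)"
  using measure_lebesgue_affine[of t 0 K] by simp

lemma scaleR_add_image:
  fixes K L :: "'a::real_vector set"
  shows "(*\<^sub>R) t ` (K + L) = (*\<^sub>R) t ` K + (*\<^sub>R) t ` L"
proof safe
  fix x assume "x \<in> K + L"
  then obtain k l where "x = k + l" "k \<in> K" "l \<in> L"
    by (auto elim: set_plus_elim)
  then show "t *\<^sub>R x \<in> (*\<^sub>R) t ` K + (*\<^sub>R) t ` L"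
    by (auto simp: scaleR_add_right)
next
  fix x assume "x \<in> (*\<^sub>R) t ` K + (*\<^sub>R) t ` L"
  then obtain k l where "x = t *\<^sub>R k + t *\<^sub>R l" "k \<in> K" "l \<in> L"
    by (auto elim!: set_plus_elim)
  then show "x \<in> (*\<^sub>R) t ` (K + L)"
    by (auto simp flip: scaleR_add_right)
qed

text \<open>Nonnegative coefficients exclude cancellation, so on \<open>t \<ge> 0\<close> each
  monomial alone obeys the growth bound.\<close>

lemma nonneg_poly_degree_le:
  fixes p :: "real poly"
  assumes nn: "\<And>j. coeff p j \<ge> 0" and le: "\<And>t. t \<ge> 0 \<Longrightarrow> poly p t \<le> C * (1 + t) ^ n"
  shows "degree p \<le> n"
proof (rule degree_le, intro allI impI)
  fix j assume "n < j"
  show "coeff p j = 0"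
  proof (rule ccontr)
    assume "coeff p j \<noteq> 0"
    then have c: "coeff p j > 0"
      using nn[of j] by simp
    have C: "C \<ge> 0"
      using le[of 0] nn[of 0] by (simp add: poly_0_coeff_0)
    \<comment> \<open>For \<open>t \<ge> 1\<close> the bound is at most
      \<open>C * 2 ^ n * t ^ n\<close>; this \<open>t\<close> makes \<open>coeff p j * t\<close>
      exceed \<open>C * 2 ^ n\<close>.\<close>
    define t where "t = C * 2 ^ n / coeff p j + 1"
    have t: "t \<ge> 1" "coeff p j * t > C * 2 ^ n"
      using c C by (auto simp: t_def field_simps)
    have "coeff p j * t ^ j \<le> poly p t"
    proof -
      have "j \<le> degree p"
        using c by (intro le_degree) simp
      then show ?thesis
        unfolding poly_altdef using t nn by (intro member_le_sum) auto
    qed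
    also have "\<dots> \<le> C * (1 + t) ^ n"
      using t by (intro le) simp
    also have "\<dots> \<le> C * (2 * t) ^ n"
      using t C by (intro mult_left_mono power_mono) auto
    finally have "coeff p j * t ^ (j - n) * t ^ n \<le> C * 2 ^ n * t ^ n"
      using \<open>n < j\<close> by (simp add: power_mult_distrib mult.assoc flip: power_add)
    then have "coeff p j * t ^ (j - n) \<le> C * 2 ^ n"
      using t by simp
    moreover have "t ^ 1 \<le> t ^ (j - n)"
      using t \<open>n < j\<close> by (intro power_increasing) auto
    then have "coeff p j * t \<le> coeff p j * t ^ (j - n)"
      using c by simp
    ultimately show False
      using t by simp
  qed
qed

text \<open>The degree bound comes from enclosing the body in a ball whose radius
  \<open>\<rho> + t * R\<close> grows linearly in \<open>t\<close>. It does not depend on the number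
  of segments.\<close>

lemma vol_add_zonotope_poly:
  fixes K :: "'a::euclidean_space set" and v :: "'i \<Rightarrow> 'a"
  assumes K: "compact K" "convex K" and "finite I"
  obtains p where "\<And>j. coeff p j \<ge> 0" "degree p \<le> DIM('a)"
    "\<And>t. t \<ge> 0 \<Longrightarrow> vol (K + zonotope I (\<lambda>i. t *\<^sub>R v i)) = poly p t"
proof -
  obtain p where p: "\<And>j. coeff p j \<ge> 0"
    "\<And>t. t \<ge> 0 \<Longrightarrow> vol (K + zonotope I (\<lambda>i. t *\<^sub>R v i)) = poly p t"
    using segment_affine_zonotope_poly[OF \<open>finite I\<close> segment_affine_vol K] by blast
  obtain \<rho> where \<rho>: "\<rho> > 0" "K \<subseteq> cball 0 \<rho>"
    using compact_imp_bounded[OF K(1)] by (auto simp: bounded_pos subset_iff)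
  define R where "R = (\<Sum>i\<in>I. norm (v i))"
  have R: "R \<ge> 0"
    unfolding R_def by (intro sum_nonneg) simp
  have "poly p t \<le> unit_ball_vol (real DIM('a)) * (\<rho> + R) ^ DIM('a) * (1 + t) ^ DIM('a)"
    if "t \<ge> 0" for t
  proof -
    have "zonotope I (\<lambda>i. t *\<^sub>R v i) \<subseteq> cball 0 (t * R)"
    proof (rule zonotope_subset_cball)
      fix u :: 'a
      have "(\<Sum>i\<in>I. \<bar>u \<bullet> t *\<^sub>R v i\<bar>) \<le> (\<Sum>i\<in>I. t * norm (v i) * norm u)"
      proof (rule sum_mono)
        fix i
        have "t * \<bar>u \<bullet> v i\<bar> \<le> t * (norm u * norm (v i))"
          using that by (intro mult_left_mono Cauchy_Schwarz_ineq2)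
        then show "\<bar>u \<bullet> t *\<^sub>R v i\<bar> \<le> t * norm (v i) * norm u"
          using that by (simp add: abs_mult mult_ac)
      qed
      then show "(\<Sum>i\<in>I. \<bar>u \<bullet> t *\<^sub>R v i\<bar>) \<le> t * R * norm u"
        by (simp add: R_def sum_distrib_left sum_distrib_right)
    qed fact
    then have "K + zonotope I (\<lambda>i. t *\<^sub>R v i) \<subseteq> cball 0 (\<rho> + t * R)"
      using \<rho>(2) by (force simp: set_plus_def intro: norm_triangle_le add_mono)
    then have "vol (K + zonotope I (\<lambda>i. t *\<^sub>R v i)) \<le> vol (cball (0::'a) (\<rho> + t * R))"
      using K \<open>finite I\<close> by (intro vol_mono compact_set_plus compact_zonotope) auto
    also have "\<dots> = unit_ball_vol (real DIM('a)) * (\<rho> + t * R) ^ DIM('a)"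
      using that R \<rho> by (simp add: content_cball)
    also have "\<dots> \<le> unit_ball_vol (real DIM('a)) * ((\<rho> + R) * (1 + t)) ^ DIM('a)"
      using that R \<rho> by (intro mult_left_mono power_mono) (auto simp: algebra_simps)
    finally show ?thesis
      using p that by (simp add: power_mult_distrib mult.assoc)
  qed
  then have "degree p \<le> DIM('a)"
    using p by (intro nonneg_poly_degree_le)
  then show thesis
    using that p by blast
qed

text \<open>As 0 lies in the convex set \<open>K\<close>, shrinking by \<open>a\<close> maps
  \<open>K\<close> into itself. This controls the volume under a change of radius and so turns
  inclusions between balls and zonotopes into estimates at one radius.\<close>

lemma vol_add_cball_scale:
  fixes K :: "'a::euclidean_space set"
  assumes K: "compact K" "convex K" "0 \<in> K" and a: "0 \<le> a" "a \<le> 1" and "t \<ge> 0"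
  shows "a ^ DIM('a) * vol (K + cball 0 t) \<le> vol (K + cball 0 (a * t))"
proof -
  have "(*\<^sub>R) a ` (K + cball 0 t) \<subseteq> K + cball 0 (a * t)"
    unfolding scaleR_add_image
  proof (rule set_plus_mono2)
    show "(*\<^sub>R) a ` K \<subseteq> K"
      using convexD[OF K(2) _ K(3), of _ a "1 - a"] a by auto
    show "(*\<^sub>R) a ` cball 0 t \<subseteq> cball (0::'a) (a * t)"
      using a by (auto simp: mult_left_mono)
  qed
  then have "vol ((*\<^sub>R) a ` (K + cball 0 t)) \<le> vol (K + cball 0 (a * t))"
    using K by (intro vol_mono compact_scaling compact_set_plus) auto
  then show ?thesis
    using a by (simp add: vol_scaleR)
qed

text \<open>Bolzano-Weierstrass one index at a time; passing to a further subsequence keeps the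
  limits already found.\<close>

lemma finite_convergent_subsequence:
  fixes c :: "nat \<Rightarrow> 'j \<Rightarrow> real"
  assumes "finite J" "\<And>j. j \<in> J \<Longrightarrow> bounded (range (\<lambda>m. c m j))"
  shows "\<exists>r l. strict_mono r \<and> (\<forall>j\<in>J. (\<lambda>m. c (r m) j) \<longlonglongrightarrow> l j)"
  using assms
proof (induction J rule: finite_induct)
  case empty
  then show ?case
    by (intro exI[of _ id]) (auto simp: strict_mono_def)
next
  case (insert i J)
  then obtain r l where r: "strict_mono r" "\<And>j. j \<in> J \<Longrightarrow> (\<lambda>m. c (r m) j) \<longlonglongrightarrow> l j"
    by auto
  have "bounded (range (\<lambda>m. c (r m) i))"
    using insert.prems[of i] by (rule bounded_subset) auto
  then obtain x s where s: "strict_mono s" "((\<lambda>m. c (r m) i) \<circ> s) \<longlonglongrightarrow> x"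
    using bounded_imp_convergent_subsequence by blast
  have "(\<lambda>m. c ((r \<circ> s) m) j) \<longlonglongrightarrow> (l(i := x)) j" if "j \<in> insert i J" for j
    using s LIMSEQ_subseq_LIMSEQ[OF r(2) s(1), of j] that by (auto simp: o_def)
  moreover have "strict_mono (r \<circ> s)"
    using r s by (simp add: strict_mono_o)
  ultimately show ?case by blast
qed

text \<open>Zonotopes squeezed between balls of radii \<open>1 - \<eta> m\<close> and
  \<open>1 + \<eta> m\<close> give polynomials of bounded degree that converge pointwise to the
  volume. A subsequence of their coefficients converges, so the limit is a polynomial too.\<close>

lemma steiner_poly_origin:
  fixes K :: "(real ^ 'n) set"
  assumes K: "compact K" "convex K" "0 \<in> K"
  obtains c where "\<And>j. c j \<ge> 0" "\<And>t. t \<ge> 0 \<Longrightarrow> vol (K + cball 0 t) = (\<Sum>j\<le>CARD('n). c j * t ^ j)"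
proof -
  let ?n = "CARD('n)"
  define f where "f t = vol (K + cball 0 t)" for t
  define \<eta> where "\<eta> m = 1 / (real m + 1)" for m
  have \<eta>: "\<eta> m > 0" "\<eta> m \<le> 1" for m
    by (auto simp: \<eta>_def)
  have f0: "f t \<ge> 0" for t
    by (simp add: f_def)
  have scale: "a ^ ?n * f t \<le> f (a * t)" if "0 \<le> a" "a \<le> 1" "t \<ge> 0" for a t
    using vol_add_cball_scale[OF K that] by (simp add: f_def)
  have "\<exists>p. (\<forall>j. coeff p j \<ge> 0) \<and> degree p \<le> ?n \<and>
     (\<forall>t\<ge>0. (1 - \<eta> m) ^ ?n * f t \<le> poly p t \<and> poly p t \<le> (1 + \<eta> m) ^ ?n * f t)" for m
  proof -
    obtain k and v :: "nat \<Rightarrow> real ^ 'n" where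
      v: "\<And>u. (1 - \<eta> m) * norm u \<le> (\<Sum>i<k. \<bar>u \<bullet> v i\<bar>)" "\<And>u. (\<Sum>i<k. \<bar>u \<bullet> v i\<bar>) \<le> (1 + \<eta> m) * norm u"
      using norm_approx_sum_abs_inner[OF \<eta>(1)[of m]] by metis
    obtain p where p: "\<And>j. coeff p j \<ge> 0" "degree p \<le> DIM(real ^ 'n)"
      and eq: "\<And>t. t \<ge> 0 \<Longrightarrow> vol (K + zonotope {..<k} (\<lambda>i. t *\<^sub>R v i)) = poly p t"
      by (rule vol_add_zonotope_poly[OF K(1,2) finite_lessThan]) (rule that)
    have "(1 - \<eta> m) ^ ?n * f t \<le> poly p t \<and> poly p t \<le> (1 + \<eta> m) ^ ?n * f t" if "t \<ge> 0" for t
    proof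
      let ?Z = "zonotope {..<k} (\<lambda>i. t *\<^sub>R v i)"
      have s: "(\<Sum>i<k. \<bar>u \<bullet> t *\<^sub>R v i\<bar>) = t * (\<Sum>i<k. \<bar>u \<bullet> v i\<bar>)" for u
        using that by (simp add: abs_mult sum_distrib_left)
      have Z1: "cball 0 ((1 - \<eta> m) * t) \<subseteq> ?Z"
        using mult_left_mono[OF v(1) that]
        by (intro cball_subset_zonotope) (simp_all only: s finite_lessThan mult_ac)
      have Z2: "?Z \<subseteq> cball 0 ((1 + \<eta> m) * t)"
        using mult_left_mono[OF v(2) that]
        by (intro zonotope_subset_cball) (simp_all only: s finite_lessThan mult_ac)
      have "(1 - \<eta> m) ^ ?n * f t \<le> f ((1 - \<eta> m) * t)"
        using \<eta>[of m] that by (intro scale) auto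
      also have "\<dots> \<le> vol (K + ?Z)"
        unfolding f_def using K Z1
        by (intro vol_mono compact_set_plus compact_zonotope set_plus_mono2) auto
      finally show "(1 - \<eta> m) ^ ?n * f t \<le> poly p t"
        using eq that by simp
      have "poly p t = vol (K + ?Z)"
        using eq that by simp
      also have "\<dots> \<le> f ((1 + \<eta> m) * t)"
        unfolding f_def using K Z2
        by (intro vol_mono compact_set_plus compact_zonotope set_plus_mono2) auto
      \<comment> \<open>The scaling estimate only shrinks, so it is applied at the larger radius
        with factor \<open>1 / (1 + \<eta> m)\<close>.\<close>
      also have "\<dots> \<le> (1 + \<eta> m) ^ ?n * f t"
      proof -
        have "(1 / (1 + \<eta> m)) ^ ?n * f ((1 + \<eta> m) * t) \<le> f (1 / (1 + \<eta> m) * ((1 + \<eta> m) * t))"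
          using \<eta>[of m] that by (intro scale) auto
        then show ?thesis
          using \<eta>[of m] by (simp add: power_one_over pos_divide_le_eq mult.commute)
      qed
      finally show "poly p t \<le> (1 + \<eta> m) ^ ?n * f t" .
    qed
    then show ?thesis
      using p by auto
  qed
  then obtain p where p: "\<And>m j. coeff (p m) j \<ge> 0" "\<And>m. degree (p m) \<le> ?n"
    and lo: "\<And>m t. t \<ge> 0 \<Longrightarrow> (1 - \<eta> m) ^ ?n * f t \<le> poly (p m) t"
    and up: "\<And>m t. t \<ge> 0 \<Longrightarrow> poly (p m) t \<le> (1 + \<eta> m) ^ ?n * f t"
    by metis
  have lim: "(\<lambda>m. poly (p m) t) \<longlonglongrightarrow> f t" if "t \<ge> 0" for t
  proof (rule tendsto_sandwich)
    have "\<eta> \<longlonglongrightarrow> 0"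
      using LIMSEQ_inverse_real_of_nat by (simp add: \<eta>_def[abs_def] inverse_eq_divide add.commute)
    then have "(\<lambda>m. (1 - \<eta> m) ^ ?n * f t) \<longlonglongrightarrow> (1 - 0) ^ ?n * f t"
      "(\<lambda>m. (1 + \<eta> m) ^ ?n * f t) \<longlonglongrightarrow> (1 + 0) ^ ?n * f t"
      by (intro tendsto_intros | assumption)+
    then show "(\<lambda>m. (1 - \<eta> m) ^ ?n * f t) \<longlonglongrightarrow> f t" "(\<lambda>m. (1 + \<eta> m) ^ ?n * f t) \<longlonglongrightarrow> f t"
      by simp_all
  qed (use lo up that in auto)
  have poly: "poly (p m) t = (\<Sum>j\<le>?n. coeff (p m) j * t ^ j)" for m t
    unfolding poly_altdef using p(2)[of m] by (intro sum.mono_neutral_left) (auto simp: coeff_eq_0)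
  have "bounded (range (\<lambda>m. coeff (p m) j))" if "j \<in> {..?n}" for j
  proof (rule boundedI)
    fix x assume "x \<in> range (\<lambda>m. coeff (p m) j)"
    then obtain m where x: "x = coeff (p m) j" by auto
    \<comment> \<open>All coefficients being nonnegative, each is at most the value of the
      polynomial at 1.\<close>
    have "coeff (p m) j * 1 ^ j \<le> poly (p m) 1"
      unfolding poly using p(1) that by (intro member_le_sum) auto
    also have "\<dots> \<le> (1 + \<eta> m) ^ ?n * f 1"
      by (intro up) simp
    also have "\<dots> \<le> 2 ^ ?n * f 1"
      using \<eta>[of m] f0 by (intro mult_right_mono power_mono) auto
    finally show "norm x \<le> 2 ^ ?n * f 1"
      using p(1) by (simp add: x)
  qed
  then obtain r c where r: "strict_mono r" and c: "\<And>j. j \<le> ?n \<Longrightarrow> (\<lambda>m. coeff (p (r m)) j) \<longlonglongrightarrow> c j"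
    using finite_convergent_subsequence[of "{..?n}" "\<lambda>m j. coeff (p m) j"] by auto
  \<comment> \<open>Nothing is known about \<open>c j\<close> for \<open>j > ?n\<close>; the maximum
    with 0 makes every coefficient nonnegative and changes none up to \<open>?n\<close>.\<close>
  have "f t = (\<Sum>j\<le>?n. max 0 (c j) * t ^ j)" if "t \<ge> 0" for t
  proof (rule LIMSEQ_unique)
    show "(\<lambda>m. poly (p (r m)) t) \<longlonglongrightarrow> f t"
      using LIMSEQ_subseq_LIMSEQ[OF lim[OF that] r] by (simp add: o_def)
    have "c j \<ge> 0" if "j \<le> ?n" for j
      using c[OF that] by (rule LIMSEQ_le_const) (use p in auto)
    then have "(\<Sum>j\<le>?n. max 0 (c j) * t ^ j) = (\<Sum>j\<le>?n. c j * t ^ j)"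
      by (intro sum.cong) auto
    then show "(\<lambda>m. poly (p (r m)) t) \<longlonglongrightarrow> (\<Sum>j\<le>?n. max 0 (c j) * t ^ j)"
      unfolding poly using c by (auto intro!: tendsto_intros)
  qed
  then show thesis
    by (intro that[of "\<lambda>j. max 0 (c j)"]) (auto simp: f_def)
qed

text \<open>Translating a point of \<open>K\<close> to the origin changes no volume and reduces to
  the case already treated.\<close>

lemma steiner_formula_exists:
  fixes K :: "(real ^ 'n) set"
  assumes "convex_body K"
  obtains V where "steiner_formula K V" "\<And>j. V j \<ge> 0"
proof -
  let ?n = "CARD('n)"
  have K: "compact K" "convex K"
    using assms by (auto simp: convex_body_def)
  obtain a where "a \<in> K"
    using assms interior_subset by (fastforce simp: convex_body_def)
  define L where "L = (+) (- a) ` K"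
  have L: "compact L" "convex L" "0 \<in> L"
    unfolding L_def using compact_translation[OF K(1)] convex_translation[OF K(2)] \<open>a \<in> K\<close>
    by (blast, blast) (rule image_eqI[of _ _ a], simp, fact)
  obtain c where c: "\<And>j. c j \<ge> 0" "\<And>t. t \<ge> 0 \<Longrightarrow> vol (L + cball 0 t) = (\<Sum>j\<le>?n. c j * t ^ j)"
    using steiner_poly_origin[OF L] by blast
  \<comment> \<open>The Steiner formula pairs index \<open>j\<close> with the power
    \<open>?n - j\<close>, hence the reversal; the value 0 beyond \<open>?n\<close> is the
    convention in \<open>steiner_formula\<close>.\<close>
  define V where "V j = (if j \<le> ?n then c (?n - j) / unit_ball_vol (real (?n - j)) else 0)" for j
  have "vol (K + (*\<^sub>R) \<epsilon> ` cball 0 1) = (\<Sum>j=0..?n. unit_ball_vol (real (?n - j)) * V j * \<epsilon> ^ (?n - j))"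
    if "\<epsilon> \<ge> 0" for \<epsilon>
  proof -
    have "L + cball 0 \<epsilon> = (+) (- a) ` (K + cball 0 \<epsilon>)"
      unfolding L_def by (force simp: set_plus_def image_iff add.assoc)
    then have "vol (K + (*\<^sub>R) \<epsilon> ` cball 0 1) = (\<Sum>j\<le>?n. c j * \<epsilon> ^ j)"
      using c(2)[OF that] by (simp add: scaleR_cball_0_1 that measure_translation_subtract)
    also have "\<dots> = (\<Sum>j\<le>?n. c (?n - j) * \<epsilon> ^ (?n - j))"
      using sum.nat_diff_reindex[of "\<lambda>j. c j * \<epsilon> ^ j" "Suc ?n"]
      by (simp add: lessThan_Suc_atMost)
    also have "\<dots> = (\<Sum>j=0..?n. unit_ball_vol (real (?n - j)) * V j * \<epsilon> ^ (?n - j))"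
      using less_imp_neq[OF unit_ball_vol_pos, symmetric]
      by (intro sum.cong) (auto simp: V_def atMost_atLeast0)
    finally show ?thesis .
  qed
  then have "steiner_formula K V"
    by (simp add: steiner_formula_def V_def)
  moreover have "V j \<ge> 0" for j
    using c by (simp add: V_def)
  ultimately show thesis
    by (rule that)
qed

text \<open>Two polynomials that agree on a half-line coincide, and the ball volumes in front of the
  coefficients are nonzero. This makes the definite description in \<open>intrinsic_volume\<close>
  meaningful.\<close>

lemma steiner_formula_unique:
  fixes K :: "'a::euclidean_space set"
  assumes V: "steiner_formula K V" and W: "steiner_formula K W"
  shows "V = W"
proof
  fix j
  let ?n = "DIM('a)"
  define P where "P V = (\<Sum>j=0..?n. monom (unit_ball_vol (real (?n - j)) * V j) (?n - j))" for V
  have "poly (P V - P W) t = 0" if "t \<ge> 0" for t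
    using V W that unfolding steiner_formula_def P_def by (simp add: poly_sum poly_monom)
  then have "{0..} \<subseteq> {t. poly (P V - P W) t = 0}"
    by auto
  then have "P V - P W = 0"
    using poly_roots_finite finite_subset infinite_Ici by blast
  then have PVW: "P V = P W" by simp
  have coeff: "coeff (P V) (?n - j) = unit_ball_vol (real (?n - j)) * V j" if "j \<le> ?n" for V
  proof -
    have "coeff (P V) (?n - j) =
      (\<Sum>i=0..?n. if i = j then unit_ball_vol (real (?n - i)) * V i else 0)"
      unfolding P_def coeff_sum coeff_monom using that by (intro sum.cong) auto
    then show ?thesis
      using that by simp
  qed
  show "V j = W j"
  proof (cases "j \<le> ?n")
    case True
    then show ?thesis
      using coeff[of V] coeff[of W] PVW less_imp_neq[OF unit_ball_vol_pos, of "real (?n - j)"] by simp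
  next
    case False
    then show ?thesis
      using V W by (simp add: steiner_formula_def)
  qed
qed

lemma intrinsic_volume_eq:
  assumes "steiner_formula K V"
  shows "intrinsic_volume j K = V j"
  unfolding intrinsic_volume_def using assms steiner_formula_unique by (metis the_equality)

lemma
  fixes K :: "(real ^ 'n) set"
  assumes "convex_body K"
  shows steiner_formula_intrinsic_volume: "steiner_formula K (\<lambda>j. intrinsic_volume j K)"
    and intrinsic_volume_nonneg: "intrinsic_volume j K \<ge> 0"
proof -
  obtain V where V: "steiner_formula K V" "\<And>j. V j \<ge> 0"
    using steiner_formula_exists[OF assms] by blast
  then show "steiner_formula K (\<lambda>j. intrinsic_volume j K)" "intrinsic_volume j K \<ge> 0"
    by (simp_all add: intrinsic_volume_eq[OF V(1)])
qed

section \<open>Lattice points\<close>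

lemma vol_add_cball:
  fixes K :: "(real ^ 'n) set"
  assumes "convex_body K" "r \<ge> 0"
  shows "vol (K + cball 0 r) = (\<Sum>j=0..CARD('n).
    unit_ball_vol (real (CARD('n) - j)) * intrinsic_volume j K * r ^ (CARD('n) - j))"
  using steiner_formula_intrinsic_volume[OF assms(1)] assms(2)
  by (simp add: steiner_formula_def scaleR_cball_0_1)

lemma intrinsic_volume_DIM:
  fixes K :: "(real ^ 'n) set"
  assumes "convex_body K"
  shows "intrinsic_volume CARD('n) K = vol K"
proof -
  have "vol K = vol (K + cball 0 0)"
    by (simp add: set_plus_def)
  also have "\<dots> = (\<Sum>j=0..CARD('n). if j = CARD('n) then intrinsic_volume j K else 0)"
    unfolding vol_add_cball[OF assms order_refl] by (intro sum.cong) auto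
  finally show ?thesis by simp
qed

text \<open>The term of index n in the Steiner formula is the volume of \<open>K\<close> itself, so
  the shell involves exactly the lower intrinsic volumes.\<close>

lemma vol_shell:
  fixes K :: "(real ^ 'n) set"
  assumes "convex_body K" "r \<ge> 0"
  shows "vol (K + cball 0 r) - vol K =
    (\<Sum>j=0..CARD('n) - 1. unit_ball_vol (real (CARD('n) - j)) * intrinsic_volume j K * r ^ (CARD('n) - j))"
proof -
  obtain m where m: "CARD('n) = Suc m"
    using zero_less_card_finite[where 'a = 'n] gr0_implies_Suc by blast
  have "intrinsic_volume (Suc m) K = vol K"
    using intrinsic_volume_DIM[OF assms(1)] by (simp add: m)
  then show ?thesis
    unfolding vol_add_cball[OF assms] by (simp add: m del: of_nat_Suc)
qed

section \<open>Counting lattice points with unit cubes\<close>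

lemma finite_integer_lattice:
  fixes K :: "(real ^ 'n) set"
  assumes "bounded K"
  shows "finite (K \<inter> integer_lattice)"
proof -
  obtain b where b: "\<And>x. x \<in> K \<Longrightarrow> norm x \<le> b"
    using assms by (auto simp: bounded_iff)
  define B where "B = \<lceil>b\<rceil>"
  have "K \<inter> integer_lattice \<subseteq> (\<lambda>g. \<chi> i. of_int (g i)) ` (UNIV \<rightarrow>\<^sub>E {-B..B})"
  proof
    fix x assume x: "x \<in> K \<inter> integer_lattice"
    then have "\<forall>i. \<exists>g. x $ i = of_int g"
      by (auto simp: integer_lattice_def Ints_def)
    then obtain g where g: "\<And>i. x $ i = of_int (g i)"
      by metis
    have "\<bar>real_of_int (g i)\<bar> \<le> b" for i
      using component_le_norm_cart[of x i] b[of x] x by (simp flip: g)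
    then have "\<bar>g i\<bar> \<le> B" for i
      unfolding B_def by (metis le_ceiling_iff of_int_abs of_int_le_iff order_trans le_of_int_ceiling)
    then have "g \<in> UNIV \<rightarrow>\<^sub>E {-B..B}"
      by (auto simp: abs_le_iff minus_le_iff)
    moreover have "x = (\<chi> i. of_int (g i))"
      by (simp add: vec_eq_iff g)
    ultimately show "x \<in> (\<lambda>g. \<chi> i. of_int (g i)) ` (UNIV \<rightarrow>\<^sub>E {-B..B})"
      by blast
  qed
  then show ?thesis
    by (rule finite_subset) (intro finite_imageI finite_PiE; simp)
qed

lemma One_vec_eq: "(\<Sum>Basis :: real ^ 'n) = 1"
proof -
  have "(\<Sum>Basis :: real ^ 'n) $ i = 1" for i
    using inner_sum_Basis[of "axis i (1::real) :: real ^ 'n"]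
    by (simp add: inner_axis axis_in_Basis_iff flip: cart_eq_inner_axis)
  then show ?thesis
    by (simp add: vec_eq_iff)
qed

lemma vol_unit_cbox: "vol (cbox z (z + 1 :: real ^ 'n)) = 1"
  using content_cbox_cart[of z "z + 1"] by (simp add: cbox_interval less_eq_vec_def interval_ne_empty_cart)

lemma vol_unit_box: "vol (box z (z + 1 :: real ^ 'n)) = 1"
  using vol_unit_cbox[of z] by (simp add: measure_lborel_box_eq measure_lborel_cbox_eq)

lemma norm_unit_cbox_le:
  fixes x z :: "real ^ 'n"
  assumes "x \<in> cbox z (z + 1)"
  shows "norm (x - z) \<le> real CARD('n)"
proof -
  have "norm (x - z) \<le> (\<Sum>i\<in>UNIV. \<bar>(x - z) $ i\<bar>)"
    by (rule norm_le_l1_cart)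
  also have "\<dots> \<le> (\<Sum>i\<in>(UNIV :: 'n set). 1)"
  proof (rule sum_mono)
    fix i
    have "z $ i \<le> x $ i" "x $ i \<le> z $ i + 1"
      using assms by (auto simp: mem_box_cart)
    then show "\<bar>(x - z) $ i\<bar> \<le> 1" by simp
  qed
  finally show ?thesis by simp
qed

lemma integer_lattice_box_disjoint:
  fixes z w :: "real ^ 'n"
  assumes "z \<in> integer_lattice" "w \<in> integer_lattice" "x \<in> box z (z + 1)" "x \<in> box w (w + 1)"
  shows "z = w"
proof -
  have "z $ i = w $ i" for i
  proof -
    obtain a b where ab: "z $ i = of_int a" "w $ i = of_int b"
      using assms unfolding integer_lattice_def Ints_def by blast
    have "of_int a < x $ i" "x $ i < of_int a + 1" "of_int b < x $ i" "x $ i < of_int b + 1"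
      using assms(3,4) by (auto simp: mem_box_cart simp flip: ab)
    then have "a = b" by linarith
    then show ?thesis by (simp add: ab)
  qed
  then show ?thesis
    by (simp add: vec_eq_iff)
qed

text \<open>The open unit boxes at the lattice points of \<open>K\<close> are disjoint, have volume
  1 and stay within distance n of \<open>K\<close>.\<close>

lemma card_lattice_le_vol:
  fixes K :: "(real ^ 'n) set"
  assumes K: "compact K"
  shows "real (card (K \<inter> integer_lattice)) \<le> vol (K + cball 0 (real CARD('n)))"
proof -
  let ?F = "K \<inter> integer_lattice"
  have fin: "finite ?F"
    using K by (intro finite_integer_lattice compact_imp_bounded)
  have "real (card ?F) = (\<Sum>z\<in>?F. vol (box z (z + 1)))"
    by (simp add: vol_unit_box)
  also have "\<dots> = vol (\<Union>z\<in>?F. box z (z + 1))"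
  proof (rule measure_UNION'[symmetric, OF fin])
    show "pairwise (\<lambda>z w. disjnt (box z (z + 1)) (box w (w + 1))) ?F"
      using integer_lattice_box_disjoint by (fastforce simp: pairwise_def disjnt_def)
  qed (simp add: lmeasurable_box)
  also have "\<dots> \<le> vol (K + cball 0 (real CARD('n)))"
  proof (rule measure_mono_fmeasurable)
    show "(\<Union>z\<in>?F. box z (z + 1)) \<subseteq> K + cball 0 (real CARD('n))"
    proof safe
      fix x z assume "x \<in> box z (z + 1)" "z \<in> K"
      then have "z + (x - z) \<in> K + cball 0 (real CARD('n))"
        using norm_unit_cbox_le[of x z] box_subset_cbox by (intro set_plus_intro) auto
      then show "x \<in> K + cball 0 (real CARD('n))" by simp
    qed
    show "K + cball 0 (real CARD('n)) \<in> lmeasurable"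
      using K by (intro lmeasurable_compact compact_set_plus) auto
  qed (use fin in auto)
  finally show ?thesis .
qed

text \<open>If \<open>x \<in> K\<close> has its integer part \<open>z\<close> outside \<open>K\<close>, then by convexity \<open>x - s \<notin> K\<close> for a vertex \<open>s\<close>
  of the unit cube. The inner shell \<open>K - (s + K)\<close> has the volume of the outer shell \<open>(s + K) - K\<close>.\<close>

lemma vol_le_card_lattice:
  obtains N where "\<And>K :: (real ^ 'n) set. compact K \<Longrightarrow> convex K \<Longrightarrow>
    vol K \<le> real (card (K \<inter> integer_lattice)) + real N * (vol (K + cball 0 (real CARD('n))) - vol K)"
proof -
  \<comment> \<open>Fixed before \<open>K\<close>, so that \<open>N = card S\<close> depends on the
    dimension only.\<close>
  obtain S :: "(real ^ 'n) set" where S: "finite S" "cbox 0 1 = convex hull S"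
    using unit_cube_convex_hull[where 'a = "real ^ 'n"] One_vec_eq by metis
  have "vol K \<le> real (card (K \<inter> integer_lattice)) +
      real (card S) * (vol (K + cball 0 (real CARD('n))) - vol K)"
    if K: "compact K" "convex K" for K :: "(real ^ 'n) set"
  proof -
    let ?F = "K \<inter> integer_lattice" and ?B = "cball (0 :: real ^ 'n) (real CARD('n))"
    have fin: "finite ?F"
      using K by (intro finite_integer_lattice compact_imp_bounded)
    have cK: "compact ((+) s ` K)" for s
      by (rule compact_translation[OF K(1)])
    have cB: "compact (K + ?B)"
      using K by (intro compact_set_plus) auto
    have subB: "K \<subseteq> K + ?B"
      using set_zero_plus2[of ?B K] by (simp add: add.commute)
    have cover: "K \<subseteq> (\<Union>z\<in>?F. cbox z (z + 1)) \<union> (\<Union>s\<in>S. K - (+) s ` K)"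
    proof
      fix x assume x: "x \<in> K"
      define z :: "real ^ 'n" where "z = (\<chi> i. of_int \<lfloor>x $ i\<rfloor>)"
      have z: "z \<in> integer_lattice"
        by (simp add: z_def integer_lattice_def)
      have xz: "x \<in> cbox z (z + 1)" "x - z \<in> cbox 0 1"
        unfolding mem_box_cart z_def by (auto simp: algebra_simps) linarith+
      show "x \<in> (\<Union>z\<in>?F. cbox z (z + 1)) \<union> (\<Union>s\<in>S. K - (+) s ` K)"
      proof (cases "z \<in> K")
        case True
        then show ?thesis
          using z xz by blast
      next
        case False
        \<comment> \<open>Otherwise \<open>x - y\<close> would lie in \<open>K\<close> for all
          \<open>y\<close> in the hull of \<open>S\<close>, in particular for
          \<open>y = x - z\<close>, which gives \<open>z\<close> in \<open>K\<close>.\<close>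
        have "\<exists>s\<in>S. x - s \<notin> K"
        proof (rule ccontr)
          assume "\<not> ?thesis"
          then have "S \<subseteq> {y. x - y \<in> K}" by auto
          moreover have "convex {y. x - y \<in> K}"
          proof (rule convexI)
            fix y y' and u v :: real
            assume "y \<in> {y. x - y \<in> K}" "y' \<in> {y. x - y \<in> K}" and uv: "0 \<le> u" "0 \<le> v" "u + v = 1"
            then have "u *\<^sub>R (x - y) + v *\<^sub>R (x - y') \<in> K"
              using K(2) by (intro convexD) auto
            also have "u *\<^sub>R (x - y) + v *\<^sub>R (x - y') = (u + v) *\<^sub>R x - (u *\<^sub>R y + v *\<^sub>R y')"
              by (simp add: algebra_simps)
            finally show "u *\<^sub>R y + v *\<^sub>R y' \<in> {y. x - y \<in> K}"
              using uv by simp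
          qed
          ultimately have "convex hull S \<subseteq> {y. x - y \<in> K}"
            by (rule hull_minimal)
          then show False
            using xz(2) False unfolding S(2) by auto
        qed
        then obtain s where "s \<in> S" "x - s \<notin> K" by blast
        then have "x \<notin> (+) s ` K" by auto
        then show ?thesis
          using \<open>s \<in> S\<close> x by blast
      qed
    qed
    have shell: "vol (K - (+) s ` K) \<le> vol (K + ?B) - vol K" if "s \<in> S" for s
    proof -
      have "s \<in> cbox 0 1"
        using S hull_inc[OF that] by simp
      then have s: "s \<in> ?B"
        using norm_unit_cbox_le[of s 0] by simp
      \<comment> \<open>\<open>K\<close> and its translate have equal volume, so removing their
        intersection from either leaves the same volume; the part of the translate outside
        \<open>K\<close> lies in the outer shell.\<close>
      have "vol (K - (+) s ` K) = vol (K - (K \<inter> (+) s ` K))"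
        by (simp add: Diff_Int)
      also have "\<dots> = vol K - vol (K \<inter> (+) s ` K)"
        using K cK by (intro vol_diff) auto
      also have "\<dots> = vol ((+) s ` K) - vol (K \<inter> (+) s ` K)"
        by (simp add: measure_translation)
      also have "\<dots> = vol ((+) s ` K - (K \<inter> (+) s ` K))"
        using K cK by (intro vol_diff[symmetric]) auto
      also have "\<dots> \<le> vol ((K + ?B) - K)"
      proof (rule measure_mono_fmeasurable)
        show "(+) s ` K - (K \<inter> (+) s ` K) \<subseteq> (K + ?B) - K"
          using s by (auto simp: add.commute[of s])
        show "(+) s ` K - (K \<inter> (+) s ` K) \<in> sets lebesgue"
          using K cK by (intro sets.Diff sets.Int fmeasurableD lmeasurable_compact)
        show "(K + ?B) - K \<in> lmeasurable"
          using K cB by (intro fmeasurable.Diff lmeasurable_compact)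
      qed
      also have "\<dots> = vol (K + ?B) - vol K"
        using K cB subB by (intro vol_diff)
      finally show ?thesis .
    qed
    have m1: "(\<Union>z\<in>?F. cbox z (z + 1)) \<in> lmeasurable"
      using fin by (intro fmeasurable.finite_UN) auto
    have m2: "(\<Union>s\<in>S. K - (+) s ` K) \<in> lmeasurable"
      using S K cK by (intro fmeasurable.finite_UN fmeasurable.Diff lmeasurable_compact) auto
    have "vol K \<le> vol ((\<Union>z\<in>?F. cbox z (z + 1)) \<union> (\<Union>s\<in>S. K - (+) s ` K))"
      using fmeasurableD[OF lmeasurable_compact[OF K(1)]]
      by (intro measure_mono_fmeasurable fmeasurable.Un m1 m2 cover)
    also have "\<dots> \<le> vol (\<Union>z\<in>?F. cbox z (z + 1)) + vol (\<Union>s\<in>S. K - (+) s ` K)"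
      using m1 m2 by (intro measure_Un_le fmeasurableD)
    also have "vol (\<Union>z\<in>?F. cbox z (z + 1)) \<le> (\<Sum>z\<in>?F. vol (cbox z (z + 1)))"
      using fin by (intro measure_UNION_le) auto
    also have "\<dots> = real (card ?F)"
      by (simp add: vol_unit_cbox)
    also have "vol (\<Union>s\<in>S. K - (+) s ` K) \<le> (\<Sum>s\<in>S. vol (K - (+) s ` K))"
      using S K cK by (intro measure_UNION_le sets.Diff fmeasurableD lmeasurable_compact)
    also have "\<dots> \<le> (\<Sum>s\<in>S. vol (K + ?B) - vol K)"
      by (intro sum_mono shell)
    also have "\<dots> = real (card S) * (vol (K + ?B) - vol K)"
      by simp
    finally show ?thesis by simp
  qed
  then show thesis
    by (rule that)
qed

text \<open>Excess and deficit of the count are at most 1 and \<open>N\<close> times the volume of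
  the outer shell of width n, which the Steiner formula bounds by the lower intrinsic
  volumes.\<close>

lemma lattice_discrepancy:
  obtains C where "C > 0" "\<And>K :: (real ^ 'n) set. convex_body K \<Longrightarrow>
    \<bar>real (card (K \<inter> integer_lattice)) - vol K\<bar> \<le> C * (\<Sum>j=0..CARD('n) - 1. intrinsic_volume j K)"
proof -
  let ?n = "CARD('n)"
  obtain N where N: "\<And>K :: (real ^ 'n) set. compact K \<Longrightarrow> convex K \<Longrightarrow>
    vol K \<le> real (card (K \<inter> integer_lattice)) + real N * (vol (K + cball 0 (real ?n)) - vol K)"
    using vol_le_card_lattice by blast
  define M where "M = (\<Sum>j=0..?n - 1. unit_ball_vol (real (?n - j)) * real ?n ^ (?n - j))"
  have term_nonneg: "unit_ball_vol (real (?n - j)) * real ?n ^ (?n - j) \<ge> 0" for j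
    by simp
  then have "M \<ge> 0"
    unfolding M_def by (intro sum_nonneg)
  \<comment> \<open>The added 1 makes the constant positive when only \<open>M \<ge> 0\<close> is
    known, at the cost of one nonnegative sum.\<close>
  have "\<bar>real (card (K \<inter> integer_lattice)) - vol K\<bar>
      \<le> ((1 + real N) * M + 1) * (\<Sum>j=0..?n - 1. intrinsic_volume j K)"
    if K: "convex_body K" for K :: "(real ^ 'n) set"
  proof -
    let ?s = "vol (K + cball 0 (real ?n)) - vol K" and ?V = "\<Sum>j=0..?n - 1. intrinsic_volume j K"
    have cK: "compact K" "convex K"
      using K by (auto simp: convex_body_def)
    have V: "?V \<ge> 0"
      by (intro sum_nonneg intrinsic_volume_nonneg[OF K])
    have "?s = (\<Sum>j=0..?n - 1. unit_ball_vol (real (?n - j)) * intrinsic_volume j K * real ?n ^ (?n - j))"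
      by (intro vol_shell K) simp
    also have "\<dots> \<le> (\<Sum>j=0..?n - 1. M * intrinsic_volume j K)"
    proof (rule sum_mono)
      fix j assume "j \<in> {0..?n - 1}"
      then have "unit_ball_vol (real (?n - j)) * real ?n ^ (?n - j) \<le> M"
        unfolding M_def by (intro member_le_sum) (auto simp: term_nonneg)
      from mult_right_mono[OF this intrinsic_volume_nonneg[OF K, of j]]
      show "unit_ball_vol (real (?n - j)) * intrinsic_volume j K * real ?n ^ (?n - j) \<le> M * intrinsic_volume j K"
        by (simp add: mult_ac)
    qed
    finally have s: "?s \<le> M * ?V"
      by (simp add: sum_distrib_left)
    have "?s \<ge> 0"
      using vol_mono[OF cK(1) compact_set_plus[OF cK(1) compact_cball[of 0 "real ?n"]]]
        set_zero_plus2[of "cball 0 (real ?n)" K] by (simp add: add.commute)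
    moreover from this have "real N * ?s \<ge> 0"
      by simp
    moreover have "real (card (K \<inter> integer_lattice)) - vol K \<le> ?s"
      using card_lattice_le_vol[OF cK(1)] by simp
    moreover have "vol K - real (card (K \<inter> integer_lattice)) \<le> real N * ?s"
      using N[OF cK] by simp
    ultimately have "\<bar>real (card (K \<inter> integer_lattice)) - vol K\<bar> \<le> ?s + real N * ?s"
      unfolding abs_le_iff by (intro conjI; linarith)
    also have "\<dots> = (1 + real N) * ?s"
      by (simp only: distrib_right mult_1)
    also have "\<dots> \<le> (1 + real N) * (M * ?V)"
      by (intro mult_left_mono s) simp
    finally show ?thesis
      using V by (simp add: algebra_simps)
  qed
  moreover have "(1 + real N) * M + 1 > 0"
    using \<open>M \<ge> 0\<close> by (simp add: add_nonneg_pos)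
  ultimately show thesis
    using that by blast
qed

section \<open>Homothetic families\<close>

lemma convex_body_scaleR:
  fixes K :: "'a::euclidean_space set"
  assumes "convex_body K" "t > 0"
  shows "convex_body ((*\<^sub>R) t ` K)"
proof -
  have "interior ((*\<^sub>R) t ` K) = (*\<^sub>R) t ` interior K"
    using assms by (intro interior_injective_linear_image) (auto simp: inj_on_def linear_scaleR)
  then show ?thesis
    using assms by (auto simp: convex_body_def compact_scaling convex_scaling)
qed

text \<open>Writing \<open>t K + \<epsilon> B\<close> as \<open>t (K + (\<epsilon> / t) B)\<close>
  yields a Steiner formula for \<open>t K\<close>, and uniqueness identifies its
  coefficients.\<close>

lemma intrinsic_volume_scaleR:
  fixes K :: "(real ^ 'n) set"
  assumes K: "convex_body K" and "t > 0"
  shows "intrinsic_volume j ((*\<^sub>R) t ` K) = t ^ j * intrinsic_volume j K"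
proof (rule intrinsic_volume_eq)
  let ?n = "CARD('n)"
  have V: "steiner_formula K (\<lambda>j. intrinsic_volume j K)"
    by (rule steiner_formula_intrinsic_volume[OF K])
  show "steiner_formula ((*\<^sub>R) t ` K) (\<lambda>j. t ^ j * intrinsic_volume j K)"
    unfolding steiner_formula_def
  proof (intro conjI allI impI)
    fix j assume "DIM(real ^ 'n) < j"
    then show "t ^ j * intrinsic_volume j K = 0"
      using V by (simp add: steiner_formula_def)
  next
    fix \<epsilon> :: real assume "\<epsilon> \<ge> 0"
    have "(*\<^sub>R) t ` K + (*\<^sub>R) \<epsilon> ` cball 0 1 = (*\<^sub>R) t ` (K + (*\<^sub>R) (\<epsilon> / t) ` cball 0 1)"
      using \<open>t > 0\<close> by (simp add: scaleR_add_image image_image)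
    then have "vol ((*\<^sub>R) t ` K + (*\<^sub>R) \<epsilon> ` cball 0 1) = t ^ ?n * vol (K + (*\<^sub>R) (\<epsilon> / t) ` cball 0 1)"
      using \<open>t > 0\<close> by (simp add: vol_scaleR)
    also have "vol (K + (*\<^sub>R) (\<epsilon> / t) ` cball 0 1) =
      (\<Sum>j=0..?n. unit_ball_vol (real (?n - j)) * intrinsic_volume j K * (\<epsilon> / t) ^ (?n - j))"
      using V \<open>\<epsilon> \<ge> 0\<close> \<open>t > 0\<close> by (simp add: steiner_formula_def)
    also have "t ^ ?n * \<dots> =
      (\<Sum>j=0..?n. unit_ball_vol (real (?n - j)) * (t ^ j * intrinsic_volume j K) * \<epsilon> ^ (?n - j))"
      unfolding sum_distrib_left
    proof (rule sum.cong)
      fix j assume "j \<in> {0..?n}"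
      then have "t ^ ?n = t ^ j * t ^ (?n - j)"
        by (simp flip: power_add)
      then show "t ^ ?n * (unit_ball_vol (real (?n - j)) * intrinsic_volume j K * (\<epsilon> / t) ^ (?n - j)) =
        unit_ball_vol (real (?n - j)) * (t ^ j * intrinsic_volume j K) * \<epsilon> ^ (?n - j)"
        using \<open>t > 0\<close> by (simp add: power_divide)
    qed simp
    finally show "vol ((*\<^sub>R) t ` K + (*\<^sub>R) \<epsilon> ` cball 0 1) = (\<Sum>j=0..DIM(real ^ 'n).
      unit_ball_vol (real (DIM(real ^ 'n) - j)) * (t ^ j * intrinsic_volume j K) * \<epsilon> ^ (DIM(real ^ 'n) - j))"
      by simp
  qed
qed

lemma vol_convex_body_pos:
  fixes K :: "'a::euclidean_space set"
  assumes "convex_body K"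
  shows "vol K > 0"
proof -
  obtain x e where e: "e > 0" "cball x e \<subseteq> K"
    using assms by (auto simp: convex_body_def) (meson mem_interior_cball)
  have "0 < vol (cball x e)"
    using e by simp
  also have "\<dots> \<le> vol K"
    using e assms by (intro vol_mono) (auto simp: convex_body_def)
  finally show ?thesis .
qed

text \<open>If \<open>V_{n-1}\<close> vanished, the volume of the shell \<open>K + \<epsilon> B\<close> would be \<open>O(\<epsilon>\<^sup>2)\<close>; but for
  \<open>K \<subseteq> R B\<close> it contains the dilate \<open>(1 + \<epsilon> / R) K\<close>, whose excess volume is at least linear in \<open>\<epsilon>\<close>.\<close>

lemma intrinsic_volume_surface_pos:
  fixes K :: "(real ^ 'n) set"
  assumes K: "convex_body K"
  shows "intrinsic_volume (CARD('n) - 1) K > 0"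
proof (rule ccontr)
  let ?n = "CARD('n)"
  assume "\<not> ?thesis"
  then have V0: "intrinsic_volume (?n - 1) K = 0"
    using intrinsic_volume_nonneg[OF K, of "?n - 1"] by simp
  have cK: "compact K"
    using K by (simp add: convex_body_def)
  obtain R where R: "R > 0" "\<And>x. x \<in> K \<Longrightarrow> norm x \<le> R"
    using compact_imp_bounded[OF cK] by (auto simp: bounded_pos)
  define M where "M = (\<Sum>j=0..?n - 1. unit_ball_vol (real (?n - j)) * intrinsic_volume j K)"
  have term_nonneg: "unit_ball_vol (real (?n - j)) * intrinsic_volume j K \<ge> 0" for j
    using intrinsic_volume_nonneg[OF K, of j] by simp
  have "M \<ge> 0"
    unfolding M_def by (intro sum_nonneg term_nonneg)
  \<comment> \<open>Without the linear term, every remaining power of \<open>\<epsilon>\<close> has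
    exponent at least 2, and \<open>\<epsilon> \<le> 1\<close> bounds it by the square.\<close>
  have up: "vol (K + cball 0 \<epsilon>) - vol K \<le> M * \<epsilon>\<^sup>2" if \<epsilon>: "0 \<le> \<epsilon>" "\<epsilon> \<le> 1" for \<epsilon>
    unfolding vol_shell[OF K \<epsilon>(1)] M_def sum_distrib_right
  proof (rule sum_mono)
    fix j assume "j \<in> {0..?n - 1}"
    show "unit_ball_vol (real (?n - j)) * intrinsic_volume j K * \<epsilon> ^ (?n - j)
      \<le> unit_ball_vol (real (?n - j)) * intrinsic_volume j K * \<epsilon>\<^sup>2"
    proof (cases "j = ?n - 1")
      case False
      then have "\<epsilon> ^ (?n - j) \<le> \<epsilon>\<^sup>2"
        using \<open>j \<in> _\<close> \<epsilon> by (intro power_decreasing) auto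
      then show ?thesis
        by (intro mult_left_mono term_nonneg)
    qed (use V0 in simp)
  qed
  have lo: "\<epsilon> / R * vol K \<le> vol (K + cball 0 \<epsilon>) - vol K" if \<epsilon>: "0 \<le> \<epsilon>" for \<epsilon>
  proof -
    have "(*\<^sub>R) (1 + \<epsilon> / R) ` K \<subseteq> K + cball 0 \<epsilon>"
    proof safe
      fix x assume x: "x \<in> K"
      have "\<epsilon> / R * norm x \<le> \<epsilon>"
        using R(2)[OF x] R(1) \<epsilon> by (simp add: divide_simps mult_left_mono)
      then have "x + (\<epsilon> / R) *\<^sub>R x \<in> K + cball 0 \<epsilon>"
        using x R \<epsilon> by (intro set_plus_intro) auto
      then show "(1 + \<epsilon> / R) *\<^sub>R x \<in> K + cball 0 \<epsilon>"
        by (simp add: scaleR_add_left)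
    qed
    then have "vol ((*\<^sub>R) (1 + \<epsilon> / R) ` K) \<le> vol (K + cball 0 \<epsilon>)"
      using cK by (intro vol_mono compact_scaling compact_set_plus) auto
    moreover have "(1 + \<epsilon> / R) * vol K \<le> (1 + \<epsilon> / R) ^ ?n * vol K"
    proof (rule mult_right_mono)
      have "(1 + \<epsilon> / R) ^ 1 \<le> (1 + \<epsilon> / R) ^ ?n"
        using R \<epsilon> zero_less_card_finite[where 'a = 'n] by (intro power_increasing) auto
      then show "1 + \<epsilon> / R \<le> (1 + \<epsilon> / R) ^ ?n" by simp
    qed simp
    ultimately show ?thesis
      using R \<epsilon> by (simp add: vol_scaleR distrib_right)
  qed
  have pos: "vol K > 0"
    by (rule vol_convex_body_pos[OF K])
  \<comment> \<open>Ensures \<open>(M + 1) * \<epsilon> * R \<le> vol K\<close>, whereas the two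
    shell bounds give \<open>vol K \<le> M * \<epsilon> * R\<close>.\<close>
  define \<epsilon> where "\<epsilon> = min 1 (vol K / (R * (M + 1)))"
  have \<epsilon>: "0 < \<epsilon>" "\<epsilon> \<le> 1" "\<epsilon> \<le> vol K / (R * (M + 1))"
    using pos R \<open>M \<ge> 0\<close> by (auto simp: \<epsilon>_def)
  have "\<epsilon> / R * vol K \<le> M * \<epsilon>\<^sup>2"
    using up[of \<epsilon>] lo[of \<epsilon>] \<epsilon> by simp
  then have "vol K \<le> M * \<epsilon> * R"
    using \<epsilon>(1) R(1) by (simp add: power2_eq_square field_simps)
  moreover have "(M + 1) * \<epsilon> * R \<le> vol K"
    using \<epsilon>(3) R \<open>M \<ge> 0\<close> by (simp add: pos_le_divide_eq mult_ac)
  ultimately show False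
    using \<epsilon>(1) R(1) by (simp add: distrib_right) (smt (verit) mult_pos_pos)
qed

text \<open>By homogeneity the sum is a polynomial in \<open>t\<close> of degree at most n - 1. Each
  power is at most \<open>1 + t ^ (n - 1)\<close>, and positivity of \<open>v\<close> lets the top
  power be expressed by the surface term.\<close>

lemma intrinsic_volume_sum_scaleR_le:
  fixes K :: "(real ^ 'n) set"
  assumes K: "convex_body K"
  obtains C where "C > 0" "\<And>t. t > 0 \<Longrightarrow>
    (\<Sum>j=0..CARD('n) - 1. intrinsic_volume j ((*\<^sub>R) t ` K))
      \<le> C * (1 + intrinsic_volume (CARD('n) - 1) ((*\<^sub>R) t ` K))"
proof -
  let ?n = "CARD('n)"
  define A where "A = (\<Sum>j=0..?n - 1. intrinsic_volume j K)"
  define v where "v = intrinsic_volume (?n - 1) K"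
  have v: "v > 0"
    unfolding v_def by (rule intrinsic_volume_surface_pos[OF K])
  have "v \<le> A"
    unfolding v_def A_def using intrinsic_volume_nonneg[OF K]
    by (intro member_le_sum[where f = "\<lambda>j. intrinsic_volume j K"]) auto
  then have "A > 0" using v by simp
  have "(\<Sum>j=0..?n - 1. t ^ j * intrinsic_volume j K) \<le> (A + A / v) * (1 + t ^ (?n - 1) * v)"
    if t: "t > 0" for t
  proof -
    have "(\<Sum>j=0..?n - 1. t ^ j * intrinsic_volume j K) \<le> (\<Sum>j=0..?n - 1. (1 + t ^ (?n - 1)) * intrinsic_volume j K)"
    proof (intro sum_mono mult_right_mono intrinsic_volume_nonneg[OF K])
      fix j assume j: "j \<in> {0..?n - 1}"
      show "t ^ j \<le> 1 + t ^ (?n - 1)"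
      proof (cases "t \<le> 1")
        case True
        then have "t ^ j \<le> 1"
          using t by (intro power_le_one) auto
        then show ?thesis
          using zero_le_power[of t "?n - 1"] t by linarith
      next
        case False
        then have "t ^ j \<le> t ^ (?n - 1)"
          using j by (intro power_increasing) auto
        then show ?thesis by simp
      qed
    qed
    also have "\<dots> = (1 + t ^ (?n - 1)) * A"
      by (simp only: A_def sum_distrib_left)
    also have "\<dots> = A + (A / v) * (t ^ (?n - 1) * v)"
      using v by (simp add: distrib_right)
    \<comment> \<open>Only nonnegative cross terms are added.\<close>
    also have "\<dots> \<le> (A + A / v) * (1 + t ^ (?n - 1) * v)"
      using v \<open>A > 0\<close> t by (simp add: distrib_left distrib_right)
    finally show ?thesis .
  qed
  then show thesis
    using \<open>A > 0\<close> v by (intro that[of "A + A / v"]) (auto simp: intrinsic_volume_scaleR[OF K] v_def add_pos_pos)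
qed

theorem lemma5p2:
  assumes "CARD('n::finite) \<ge> 2"
  shows "\<exists>C>0.
    (\<forall>K :: (real ^ 'n) set. convex_body K \<longrightarrow>
       \<bar>real (card (K \<inter> integer_lattice)) - vol K\<bar>
         \<le> C * (\<Sum>j=0..CARD('n) - 1. intrinsic_volume j K)) \<and>
    (\<forall>K\<^sub>0 :: (real ^ 'n) set. convex_body K\<^sub>0 \<longrightarrow>
       (\<exists>C\<^sub>K>0. \<forall>t>0.
          \<bar>real (card ((*\<^sub>R) t ` K\<^sub>0 \<inter> integer_lattice)) - vol ((*\<^sub>R) t ` K\<^sub>0)\<bar>
            \<le> C * C\<^sub>K * (1 + intrinsic_volume (CARD('n) - 1) ((*\<^sub>R) t ` K\<^sub>0))))"
proof -
  obtain C where C: "C > 0" "\<And>K :: (real ^ 'n) set. convex_body K \<Longrightarrow>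
    \<bar>real (card (K \<inter> integer_lattice)) - vol K\<bar> \<le> C * (\<Sum>j=0..CARD('n) - 1. intrinsic_volume j K)"
    using lattice_discrepancy by blast
  have "\<exists>C\<^sub>K>0. \<forall>t>0.
      \<bar>real (card ((*\<^sub>R) t ` K \<inter> integer_lattice)) - vol ((*\<^sub>R) t ` K)\<bar>
        \<le> C * C\<^sub>K * (1 + intrinsic_volume (CARD('n) - 1) ((*\<^sub>R) t ` K))"
    if K: "convex_body K" for K :: "(real ^ 'n) set"
  proof -
    \<comment> \<open>\<open>D\<close> is chosen before \<open>t\<close> and serves as
      \<open>C\<^sub>K\<close>; the constant \<open>C\<close> is the one of the first part.\<close>
    obtain D where D: "D > 0" "\<And>t. t > 0 \<Longrightarrow>
      (\<Sum>j=0..CARD('n) - 1. intrinsic_volume j ((*\<^sub>R) t ` K))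
        \<le> D * (1 + intrinsic_volume (CARD('n) - 1) ((*\<^sub>R) t ` K))"
      using intrinsic_volume_sum_scaleR_le[OF K] by blast
    have "\<bar>real (card ((*\<^sub>R) t ` K \<inter> integer_lattice)) - vol ((*\<^sub>R) t ` K)\<bar>
        \<le> C * D * (1 + intrinsic_volume (CARD('n) - 1) ((*\<^sub>R) t ` K))" if "t > 0" for t
      using order_trans[OF C(2)[OF convex_body_scaleR[OF K that]] mult_left_mono[OF D(2)[OF that]]] C(1)
      by (simp add: mult.assoc)
    with D(1) show ?thesis by blast
  qed
  with C show ?thesis by blast
qed

end
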